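(* Let $\mathcal T$ be a fractal spray in $\mathbb R^d$ given by the fractal string $\mathcal L=\{\ell_j\}_{j=1}^\infty$ (with $\ell_1=1$) and a single generator $G\subseteq\mathbb R^d$ with inradius $g$, and assume that the abscissa of convergence $D$ of $\zeta_{\mathcal L}$ is strictly smaller than $d$. Assume that $G$ is monophase, with its constant-coefficient Steiner-like representation $V(G,\varepsilon)=\sum_{k=0}^d\kappa_k(G)\varepsilon^{d-k}$, $0<\varepsilon\le g$. Let $S$ be a screen, with window $W$, that avoids the integers $0,1,\dots,d$ (it is not required that $S(0)<0$; in particular $S$ may be arbitrarily close to the vertical line $\Re s=D$), and assume that $\zeta_{\mathcal L}$ is languid of order $\varkappa<1$ for $S$. Then for all $\varepsilon>0$, $$V(\mathcal T,\varepsilon)=\sum_{\omega\in\mathcal D_{\mathcal T}(W)}\operatorname{Res}_{s=\omega}\zeta_{\mathcal T}(\varepsilon,s)+\lambda_d(G)\,\zeta_{\mathcal L}(d)+\mathcal R(\varepsilon),$$ where $\mathcal R(\varepsilon)=O(\varepsilon^{d-\sup S})$ as $\varepsilon\to0^+$. Moreover, the error term is given by $$\mathcal R(\varepsilon)=\frac1{2\pi i}\int_S\zeta_{\mathcal T}(\varepsilon,s)\,ds=\frac1{2\pi i}\int_S\frac{\varepsilon^{d-s}\zeta_{\mathcal L}(s)}{d-s}\left(\sum_{k=0}^{d-1}\frac{g^{s-k}}{s-k}(d-k)\kappa_k(G)\right)ds.$$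
   Context: Fractal strings and sprays. A fractal string is a nonincreasing sequence $\mathcal L=\{\ell_j\}_{j=1}^\infty$ of positive reals with $\ell_j\to0$; throughout $\ell_1=1$. A fractal spray $\mathcal T$ on a (single) generator $G\subseteq\mathbb R^d$ (a nonempty bounded connected open set) scaled by $\mathcal L$ is a collection of pairwise disjoint bounded open sets $\{G^j\}_{j\ge1}$ in $\mathbb R^d$ such that for each $j$, $G^j=\Psi_j(G)$ for a similarity transformation $\Psi_j$ of $\mathbb R^d$ with scaling ratio $\ell_j$. Inner parallel volumes. $\lambda_d$ is Lebesgue measure. For bounded open $A\subseteq\mathbb R^d$ and $\varepsilon>0$, $A_{-\varepsilon}:=\{x\in A:\operatorname{dist}(x,A^c)\le\varepsilon\}$ and $V(A,\varepsilon):=\lambda_d(A_{-\varepsilon})$. Also $V(\mathcal T,\varepsilon):=\lambda_d(T_{-\varepsilon})=\sum_jV(G^j,\varepsilon)$ with $T=\bigcup_jG^j$. The inradius $g$ of $G$ is the radius of the largest open ball contained in $G$. Monophase. $G$ is monophase if there are constants $\kappa_0(G),\dots,\kappa_d(G)\in\mathbb R$ with $V(G,\varepsilon)=\sum_{k=0}^d\kappa_k(G)\varepsilon^{d-k}$ for $0<\varepsilon\le g$. Then one always uses $\kappa_k(G,\varepsilon):=\kappa_k(G)$ for all $\varepsilon>0$. Zeta functions. $\zeta_{\mathcal L}(s)=\sum_j\ell_j^s$ for $\Re s>D$, where $D$ is the abscissa of convergence; $\zeta_{\mathcal L}$ also denotes its meromorphic continuation. The tubular zeta function is (the meromorphic extension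 in $s$ of) $$\zeta_{\mathcal T}(\varepsilon,s)=\varepsilon^{d-s}\sum_{j=1}^\infty\ell_j^s\left(\sum_{k=0}^d\frac{g^{s-k}}{s-k}\kappa_k(G,\ell_j^{-1}\varepsilon)-\frac{g^{s-d}}{s-d}\lambda_d(G)\right).$$ Screens. A screen is the contour $S=\{S(t)+it:t\in\mathbb R\}$, where $S:\mathbb R\to(-\infty,D]$ is a bounded Lipschitz function; $\sup S:=\sup_tS(t)$. The window is $W=\{z:\Re z\ge S(\Im z)\}$. A screen is always chosen so that $\zeta_{\mathcal L}$ is meromorphic in a connected open neighborhood of $W$ and no pole of $\zeta_{\mathcal L}$ lies on $S$. $\int_S$ is taken upwards: $\int_Sf(s)\,ds=\int_{\mathbb R}f(S(t)+it)(S'(t)+i)\,dt$. Complex dimensions. $\mathcal D_{\mathcal L}(W)$ is the set of poles of $\zeta_{\mathcal L}$ in $W$ and $\mathcal D_{\mathcal T}(W):=\mathcal D_{\mathcal L}(W)\cup(\{0,1,\dots,d\}\cap W)$. Languidness. Let $\{T_n\}_{n\in\mathbb Z}\subset\mathbb R$ with $T_{-n}<0<T_n$ for $n\ge1$, $T_n\to\infty$, $T_{-n}\to-\infty$, $T_n/|T_{-n}|\to1$ as $n\to\infty$. $\zeta_{\mathcal L}$ is languid of order $\varkappa\in\mathbb R$ (for $S$) if for some such sequence and some $c>0$: (L1) $|\zeta_{\mathcal L}(\alpha+iT_n)|\le c(|T_n|+1)^\varkappa$ for all $n\in\mathbb Z$ and all $\alpha\ge S(T_n)$; (L2) $|\zeta_{\mathcal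 L}(S(t)+it)|\le c|t|^\varkappa$ for all $|t|\ge1$. Convention. An infinite sum over complex dimensions is understood as $\lim_{n\to\infty}$ of the sums over those $\omega$ with $T_{-n}<\Im\omega<T_n$, where $\{T_n\}$ is the sequence from the languidness condition. *)

theory Defs
  imports "HOL-Complex_Analysis.Complex_Analysis"
begin

section \<open>Fractal strings and sprays\<close>

text \<open>Strings are indexed from 0, so the first length is \<open>L 0\<close>.\<close>

definition fractal_string :: "(nat \<Rightarrow> real) \<Rightarrow> bool" where
  "fractal_string L \<longleftrightarrow> (\<forall>j. L j > 0) \<and> decseq L \<and> L \<longlonglongrightarrow> 0 \<and> L 0 = 1"

definition similarity :: "real \<Rightarrow> ('a::metric_space \<Rightarrow> 'a) \<Rightarrow> bool" where
  "similarity r \<Psi> \<longleftrightarrow> r > 0 \<and> (\<forall>x y. dist (\<Psi> x) (\<Psi> y) = r * dist x y)"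

definition generator :: "'a::euclidean_space set \<Rightarrow> bool" where
  "generator G \<longleftrightarrow> G \<noteq> {} \<and> bounded G \<and> connected G \<and> open G"

definition fractal_spray ::
  "(nat \<Rightarrow> real) \<Rightarrow> 'a::euclidean_space set \<Rightarrow> (nat \<Rightarrow> 'a set) \<Rightarrow> bool" where
  "fractal_spray L G Gs \<longleftrightarrow>
     fractal_string L \<and> generator G \<and> disjoint_family Gs \<and>
     (\<forall>j. bounded (Gs j) \<and> open (Gs j)) \<and>
     (\<forall>j. \<exists>\<Psi>. similarity (L j) \<Psi> \<and> Gs j = \<Psi> ` G)"

section \<open>Inner parallel volumes\<close>

definition inner_parallel :: "'a::euclidean_space set \<Rightarrow> real \<Rightarrow> 'a set" where
  "inner_parallel A \<epsilon> = {x \<in> A. infdist x (- A) \<le> \<epsilon>}"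

definition inner_volume :: "'a::euclidean_space set \<Rightarrow> real \<Rightarrow> real" where
  "inner_volume A \<epsilon> = measure lebesgue (inner_parallel A \<epsilon>)"

definition spray_volume :: "(nat \<Rightarrow> 'a::euclidean_space set) \<Rightarrow> real \<Rightarrow> real" where
  "spray_volume Gs \<epsilon> = inner_volume (\<Union>j. Gs j) \<epsilon>"

definition inradius :: "'a::euclidean_space set \<Rightarrow> real" where
  "inradius G = Sup {r. r > 0 \<and> (\<exists>x. ball x r \<subseteq> G)}"

definition monophase_with :: "'a::euclidean_space set \<Rightarrow> (nat \<Rightarrow> real) \<Rightarrow> bool" where
  "monophase_with G \<kappa> \<longleftrightarrow>
     (\<forall>\<epsilon>. 0 < \<epsilon> \<and> \<epsilon> \<le> inradius G \<longrightarrow>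
        inner_volume G \<epsilon> = (\<Sum>k\<le>DIM('a). \<kappa> k * \<epsilon> ^ (DIM('a) - k)))"

section \<open>Meromorphic continuation\<close>

text \<open>
  Meromorphic functions are normalised by \<open>nicely_meromorphic_on\<close>: they are continuous
  at every point of \<open>U\<close> that is not a pole, and take the value 0 at poles. If \<open>U\<close> is open
  and connected and \<open>A\<close> has an accumulation point in \<open>U\<close>, a continuation from \<open>A\<close> to \<open>U\<close>
  is unique on \<open>U\<close>; off \<open>U\<close> the value of \<open>meromorphic_continuation\<close> is meaningless.
\<close>

definition continues_to ::
  "(complex \<Rightarrow> complex) \<Rightarrow> complex set \<Rightarrow> complex set \<Rightarrow> (complex \<Rightarrow> complex) \<Rightarrow> bool" where
  "continues_to f A U F \<longleftrightarrow> A \<subseteq> U \<and> F nicely_meromorphic_on U \<and> (\<forall>s\<in>A. F s = f s)"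

definition meromorphic_continuation ::
  "(complex \<Rightarrow> complex) \<Rightarrow> complex set \<Rightarrow> complex set \<Rightarrow> complex \<Rightarrow> complex" where
  "meromorphic_continuation f A U = (SOME F. continues_to f A U F)"

section \<open>Zeta functions\<close>

text \<open>The abscissa is \<open>\<infinity>\<close> if the series diverges for every real exponent.\<close>

definition abscissa :: "(nat \<Rightarrow> real) \<Rightarrow> ereal" where
  "abscissa L = Inf (ereal ` {\<sigma>. summable (\<lambda>j. L j powr \<sigma>)})"

definition convergence_halfplane :: "(nat \<Rightarrow> real) \<Rightarrow> complex set" where
  "convergence_halfplane L = {s. abscissa L < ereal (Re s)}"

definition string_zeta_series :: "(nat \<Rightarrow> real) \<Rightarrow> complex \<Rightarrow> complex" where
  "string_zeta_series L s = (\<Sum>j. of_real (L j) powr s)"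

definition string_zeta :: "(nat \<Rightarrow> real) \<Rightarrow> complex set \<Rightarrow> complex \<Rightarrow> complex" where
  "string_zeta L U =
     meromorphic_continuation (string_zeta_series L) (convergence_halfplane L) U"

text \<open>The coefficients \<open>\<kappa> k \<epsilon>\<close> may depend on \<open>\<epsilon>\<close>; for monophase generators they do not.\<close>

definition tubular_zeta_series ::
  "'a::euclidean_space set \<Rightarrow> (nat \<Rightarrow> real \<Rightarrow> real) \<Rightarrow> (nat \<Rightarrow> real) \<Rightarrow> real \<Rightarrow> complex \<Rightarrow> complex"
where
  "tubular_zeta_series G \<kappa> L \<epsilon> s =
     (let d = DIM('a); g = complex_of_real (inradius G) in
      of_real \<epsilon> powr (of_nat d - s) *
      (\<Sum>j. of_real (L j) powr s *
         ((\<Sum>k\<le>d. g powr (s - of_nat k) / (s - of_nat k) * of_real (\<kappa> k (inverse (L j) * \<epsilon>)))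
          - g powr (s - of_nat d) / (s - of_nat d) * of_real (measure lebesgue G))))"

text \<open>
  The integers \<open>0,\<dots>,d\<close> are removed from the initial domain because the terms of the series
  have denominators vanishing there.
\<close>

definition tubular_zeta ::
  "'a::euclidean_space set \<Rightarrow> (nat \<Rightarrow> real \<Rightarrow> real) \<Rightarrow> (nat \<Rightarrow> real) \<Rightarrow> complex set
     \<Rightarrow> real \<Rightarrow> complex \<Rightarrow> complex"
where
  "tubular_zeta G \<kappa> L U \<epsilon> =
     meromorphic_continuation (tubular_zeta_series G \<kappa> L \<epsilon>)
       (convergence_halfplane L - of_nat ` {0..DIM('a)}) U"

section \<open>Screens, windows and complex dimensions\<close>

definition window :: "(real \<Rightarrow> real) \<Rightarrow> complex set" where
  "window S = {z. Re z \<ge> S (Im z)}"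

text \<open>\<open>U\<close> is the connected open neighbourhood of the window on which the zeta function lives.\<close>

definition screen :: "(nat \<Rightarrow> real) \<Rightarrow> complex set \<Rightarrow> (real \<Rightarrow> real) \<Rightarrow> bool" where
  "screen L U S \<longleftrightarrow>
     (\<forall>t. ereal (S t) \<le> abscissa L) \<and> bounded (range S) \<and> (\<exists>C. C-lipschitz_on UNIV S) \<and>
     open U \<and> connected U \<and> window S \<subseteq> U \<and>
     (\<exists>F. continues_to (string_zeta_series L) (convergence_halfplane L) U F) \<and>
     (\<forall>t. \<not> is_pole (string_zeta L U) (Complex (S t) t))"

text \<open>
  A Lipschitz function is differentiable almost everywhere; the arbitrary value of \<open>deriv\<close>
  on the remaining null set does not affect the integral.
\<close>

definition screen_integrand :: "(real \<Rightarrow> real) \<Rightarrow> (complex \<Rightarrow> complex) \<Rightarrow> real \<Rightarrow> complex" where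
  "screen_integrand S f t = f (Complex (S t) t) * (of_real (deriv S t) + \<i>)"

definition has_screen_integral ::
  "(real \<Rightarrow> real) \<Rightarrow> (complex \<Rightarrow> complex) \<Rightarrow> complex \<Rightarrow> bool" where
  "has_screen_integral S f I \<longleftrightarrow>
     integrable lebesgue (screen_integrand S f) \<and> (LINT t|lebesgue. screen_integrand S f t) = I"

definition string_dims :: "(nat \<Rightarrow> real) \<Rightarrow> complex set \<Rightarrow> (real \<Rightarrow> real) \<Rightarrow> complex set" where
  "string_dims L U S = {\<omega> \<in> window S. is_pole (string_zeta L U) \<omega>}"

definition spray_dims ::
  "nat \<Rightarrow> (nat \<Rightarrow> real) \<Rightarrow> complex set \<Rightarrow> (real \<Rightarrow> real) \<Rightarrow> complex set" where
  "spray_dims d L U S = string_dims L U S \<union> (of_nat ` {0..d} \<inter> window S)"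

section \<open>Languidness\<close>

definition height_sequence :: "(int \<Rightarrow> real) \<Rightarrow> bool" where
  "height_sequence T \<longleftrightarrow>
     (\<forall>n\<ge>1. T (- n) < 0 \<and> 0 < T n) \<and>
     filterlim (\<lambda>n::nat. T (int n)) at_top sequentially \<and>
     filterlim (\<lambda>n::nat. T (- int n)) at_bot sequentially \<and>
     (\<lambda>n::nat. T (int n) / \<bar>T (- int n)\<bar>) \<longlonglongrightarrow> 1"

text \<open>
  Although \<open>\<zeta>\<close> is given the value 0 at its poles, the first bound still excludes poles at
  height \<open>T n\<close>, since it is required on the whole closed half-line.
\<close>

definition languid_along ::
  "(int \<Rightarrow> real) \<Rightarrow> (complex \<Rightarrow> complex) \<Rightarrow> (real \<Rightarrow> real) \<Rightarrow> real \<Rightarrow> bool" where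
  "languid_along T \<zeta> S \<tau> \<longleftrightarrow>
     height_sequence T \<and>
     (\<exists>c>0.
        (\<forall>n \<alpha>. \<alpha> \<ge> S (T n) \<longrightarrow> norm (\<zeta> (Complex \<alpha> (T n))) \<le> c * (\<bar>T n\<bar> + 1) powr \<tau>) \<and>
        (\<forall>t. \<bar>t\<bar> \<ge> 1 \<longrightarrow> norm (\<zeta> (Complex (S t) t)) \<le> c * \<bar>t\<bar> powr \<tau>))"

text \<open>
  Sums over complex dimensions are limits of sums over horizontal strips. Finiteness of each
  truncated index set is part of the notion, as \<open>sum\<close> is 0 on infinite sets.
\<close>

definition has_dims_sum ::
  "(int \<Rightarrow> real) \<Rightarrow> complex set \<Rightarrow> (complex \<Rightarrow> complex) \<Rightarrow> complex \<Rightarrow> bool" where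
  "has_dims_sum T \<Omega> f \<sigma> \<longleftrightarrow>
     (\<forall>n::nat. finite {\<omega> \<in> \<Omega>. T (- int n) < Im \<omega> \<and> Im \<omega> < T (int n)}) \<and>
     (\<lambda>n::nat. \<Sum>\<omega> | \<omega> \<in> \<Omega> \<and> T (- int n) < Im \<omega> \<and> Im \<omega> < T (int n). f \<omega>) \<longlonglongrightarrow> \<sigma>"

end

theory Submission
  imports Defs
begin

text \<open>
  By scaling, the volume of the spray is a sum over the pieces, in which a piece of size \<open>l\<close>
  contributes \<open>l ^ d\<close> times the inner volume of the generator at \<open>\<epsilon> / l\<close>
  (\<open>spray_volume_sums\<close>). The inner volume of a monophase generator is a polynomial up to the inradius
  \<open>g\<close> and constant from there on. Mellin inversion, in the shape of an explicit Perron integral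
  (\<open>perron_kernel\<close>), writes each summand, diminished by the total volume of the piece, as an
  integral over the line \<open>Re s = d + 1\<close>. Summing over the pieces gives the integral of the tubular
  zeta function over that line, and its value is \<open>2 \<pi> \<i>\<close> times the volume of the spray minus
  \<open>\<lambda>(G) \<zeta>(d)\<close> (\<open>spray_volume_vertical_integral\<close>).

  The tubular zeta function is the product of \<open>\<epsilon> powr (d - s)\<close>, the string zeta function
  and a kernel that depends only on the generator. As the Steiner polynomial at \<open>g\<close> is the volume of
  the generator, the kernel simplifies so that it decays quadratically in \<open>Im s\<close>
  (\<open>steiner_kernel_eq\<close>, \<open>steiner_kernel_bound\<close>). With languidness of order below 1 the product is then
  integrable over the screen, and its integrals over the horizontal segments at the heights \<open>T n\<close> tend
  to 0. Shifting the line of integration to the screen collects the residues at the complex dimensions,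
  and what remains is the integral over the screen. The error estimate follows since the factor
  \<open>\<epsilon> powr (d - s)\<close> is at most \<open>\<epsilon> powr (d - sup S)\<close> in modulus on the screen, for \<open>\<epsilon> < 1\<close>.

  The shift of the contour needs care because the screen is merely a Lipschitz graph, with a
  tangent only almost everywhere. Lipschitz functions are differentiable almost everywhere and are the
  integrals of their derivatives (\<open>lipschitz_ae_derivative\<close>, \<open>has_integral_lipschitz_derivative\<close>),
  so an integral over a short piece of the screen equals the increment of a local primitive. The region
  between the screen and the line is therefore cut into thin strips, each of which is a rectangle up
  to a set near the screen on which the integrand is holomorphic (\<open>strip_residues\<close>).
\<close>

section \<open>Similar copies and volumes of sprays\<close>

lemma similarity_decompose:
  fixes \<Psi> :: "'a::euclidean_space \<Rightarrow> 'a"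
  assumes "similarity r \<Psi>"
  obtains Q where "orthogonal_transformation Q" "\<And>x. \<Psi> x = \<Psi> 0 + r *\<^sub>R Q x"
proof
  have r: "r > 0" and D: "dist (\<Psi> x) (\<Psi> y) = r * dist x y" for x y
    using assms by (auto simp: similarity_def)
  define Q where "Q x = (1 / r) *\<^sub>R (\<Psi> x - \<Psi> 0)" for x
  have "dist (Q x) (Q y) = dist x y" for x y
    using r D[of x y] by (simp add: Q_def dist_norm flip: scaleR_diff_right)
  then show "orthogonal_transformation Q"
    unfolding orthogonal_transformation_isometry by (simp add: Q_def)
  show "\<Psi> x = \<Psi> 0 + r *\<^sub>R Q x" for x
    using r by (simp add: Q_def)
qed

lemma similarity_bij:
  fixes \<Psi> :: "'a::euclidean_space \<Rightarrow> 'a"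
  assumes "similarity r \<Psi>"
  shows "bij \<Psi>"
proof -
  obtain Q where Q: "orthogonal_transformation Q" "\<And>x. \<Psi> x = \<Psi> 0 + r *\<^sub>R Q x"
    using similarity_decompose[OF assms] by blast
  have r: "r > 0" and D: "dist (\<Psi> x) (\<Psi> y) = r * dist x y" for x y
    using assms by (auto simp: similarity_def)
  have "inj \<Psi>"
    using r D by (metis dist_eq_0_iff injI less_irrefl mult_eq_0_iff)
  moreover have "surj \<Psi>"
  proof
    show "UNIV \<subseteq> range \<Psi>"
    proof
      fix y
      obtain x where "Q x = (1 / r) *\<^sub>R (y - \<Psi> 0)"
        using orthogonal_transformation_surj[OF Q(1)] by (metis surjD)
      then have "\<Psi> x = y" using Q(2)[of x] r by simp
      then show "y \<in> range \<Psi>" by blast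
    qed
  qed simp
  ultimately show ?thesis by (simp add: bij_def)
qed

lemma similarity_image_ball:
  fixes \<Psi> :: "'a::euclidean_space \<Rightarrow> 'a"
  assumes "similarity r \<Psi>"
  shows "\<Psi> ` ball x \<rho> = ball (\<Psi> x) (r * \<rho>)"
proof -
  have r: "r > 0" and D: "dist (\<Psi> x) (\<Psi> y) = r * dist x y" for x y
    using assms by (auto simp: similarity_def)
  have "y \<in> \<Psi> ` ball x \<rho>" if "y \<in> ball (\<Psi> x) (r * \<rho>)" for y
  proof -
    obtain z where "y = \<Psi> z" using similarity_bij[OF assms] by (metis bij_pointE)
    with that r D show ?thesis by auto
  qed
  then show ?thesis using r D by auto
qed

lemma similarity_image_open:
  fixes \<Psi> :: "'a::euclidean_space \<Rightarrow> 'a"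
  assumes "similarity r \<Psi>" "open V"
  shows "open (\<Psi> ` V)"
  unfolding open_contains_ball
proof
  fix y assume "y \<in> \<Psi> ` V"
  then obtain x where x: "x \<in> V" "y = \<Psi> x" by blast
  then obtain e where e: "e > 0" "ball x e \<subseteq> V" using assms(2) openE by blast
  then have "\<Psi> ` ball x e \<subseteq> \<Psi> ` V" by blast
  then have "ball y (r * e) \<subseteq> \<Psi> ` V"
    using x similarity_image_ball[OF assms(1)] by metis
  moreover have "r * e > 0" using assms(1) e by (auto simp: similarity_def)
  ultimately show "\<exists>e>0. ball y e \<subseteq> \<Psi> ` V" by blast
qed

text \<open>By the Vitali covering theorem an open set is, up to a null set, a countable disjoint union
  of balls, and a similarity maps balls to balls.\<close>

lemma emeasure_similarity_image_open:
  fixes \<Psi> :: "'a::euclidean_space \<Rightarrow> 'a"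
  assumes sim: "similarity r \<Psi>" and "open V"
  shows "emeasure lebesgue (\<Psi> ` V) = ennreal (r ^ DIM('a)) * emeasure lebesgue V"
proof -
  have r: "r > 0" and D: "dist (\<Psi> x) (\<Psi> y) = r * dist x y" for x y
    using sim by (auto simp: similarity_def)
  have inj: "inj \<Psi>" using similarity_bij[OF sim] by (simp add: bij_def)
  define K where "K = {p :: 'a \<times> real. 0 < snd p \<and> ball (fst p) (snd p) \<subseteq> V}"
  have cov: "\<exists>i. i \<in> K \<and> x \<in> ball (fst i) (snd i) \<and> snd i < e" if "x \<in> V" "0 < e" for x e
  proof -
    obtain \<delta> where "\<delta> > 0" "ball x \<delta> \<subseteq> V" using \<open>open V\<close> \<open>x \<in> V\<close> openE by blast
    then show ?thesis using that
      by (intro exI[of _ "(x, min \<delta> (e/2))"]) (auto simp: K_def)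
  qed
  obtain C where C: "countable C" "C \<subseteq> K"
     and dj: "pairwise (\<lambda>i j. disjnt (ball (fst i) (snd i)) (ball (fst j) (snd j))) C"
     and neg: "negligible (V - (\<Union>i\<in>C. ball (fst i) (snd i)))"
    using Vitali_covering_theorem_balls[OF cov] by blast
  define B where "B i = ball (fst i) (snd i)" for i :: "'a \<times> real"
  define N where "N = V - (\<Union>i\<in>C. B i)"
  have N: "negligible N" using neg by (simp add: N_def B_def)
  have VB: "V = (\<Union>i\<in>C. B i) \<union> N"
    using C(2) by (auto simp: N_def K_def B_def)
  have "negligible (\<Psi> ` N)"
  proof (rule negligible_locally_Lipschitz_image[OF _ N])
    show "\<exists>T B. open T \<and> x \<in> T \<and> (\<forall>y\<in>N \<inter> T. norm (\<Psi> y - \<Psi> x) \<le> B * norm (y - x))" if "x \<in> N" for x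
      using D by (intro exI[of _ UNIV] exI[of _ r]) (auto simp: dist_norm)
  qed simp
  then have N': "\<Psi> ` N \<in> null_sets lebesgue" and N0: "N \<in> null_sets lebesgue"
    using N by (auto simp: negligible_iff_null_sets)
  have dB: "disjoint_family_on B C"
    using dj unfolding disjoint_family_on_def pairwise_def disjnt_def B_def by blast
  have dPB: "disjoint_family_on (\<lambda>i. \<Psi> ` B i) C"
    using dB unfolding disjoint_family_on_def
    by (metis inj image_Int image_empty)
  have PB: "\<Psi> ` B i = ball (\<Psi> (fst i)) (r * snd i)" for i
    unfolding B_def by (rule similarity_image_ball[OF sim])
  have eB: "emeasure lebesgue (\<Psi> ` B i) = ennreal (r ^ DIM('a)) * emeasure lebesgue (B i)" if "i \<in> C" for i
  proof -
    have s: "snd i > 0" using that C(2) by (auto simp: K_def)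
    have f: "emeasure lebesgue (ball (x::'a) \<rho>) = ennreal (measure lborel (ball x \<rho>))" for x \<rho>
      using emeasure_lborel_ball_finite[of x \<rho>] by (simp add: emeasure_eq_ennreal_measure)
    have "measure lborel (ball (\<Psi> (fst i)) (r * snd i)) = r ^ DIM('a) * measure lborel (ball (fst i) (snd i))"
      using r s content_ball_conv_unit_ball[of "r * snd i" "\<Psi> (fst i)"] content_ball_conv_unit_ball[of "snd i" "fst i"]
      by (simp only: power_mult_distrib mult.assoc) simp
    then show ?thesis
      unfolding PB unfolding B_def f using r by (simp only: ennreal_mult'[of "r ^ DIM('a)"] zero_le_power less_imp_le)
  qed
  have "emeasure lebesgue V = emeasure lebesgue (\<Union>i\<in>C. B i)"
    unfolding VB using C(1) by (intro emeasure_Un_null_set N0 sets.countable_UN') (auto simp: B_def)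
  also have "\<dots> = (\<integral>\<^sup>+i. emeasure lebesgue (B i) \<partial>count_space C)"
    using C(1) by (intro emeasure_UN_countable dB) (auto simp: B_def)
  finally have 1: "emeasure lebesgue V = (\<integral>\<^sup>+i. emeasure lebesgue (B i) \<partial>count_space C)" .
  have "\<Psi> ` V = (\<Union>i\<in>C. \<Psi> ` B i) \<union> \<Psi> ` N"
    by (subst VB) blast
  then have "emeasure lebesgue (\<Psi> ` V) = emeasure lebesgue (\<Union>i\<in>C. \<Psi> ` B i)"
    using C(1) by (simp only:, intro emeasure_Un_null_set N' sets.countable_UN') (auto simp: PB)
  also have "\<dots> = (\<integral>\<^sup>+i. emeasure lebesgue (\<Psi> ` B i) \<partial>count_space C)"
    using C(1) by (intro emeasure_UN_countable dPB) (auto simp: PB)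
  also have "\<dots> = (\<integral>\<^sup>+i. ennreal (r ^ DIM('a)) * emeasure lebesgue (B i) \<partial>count_space C)"
    by (intro nn_integral_cong) (simp add: eB)
  also have "\<dots> = ennreal (r ^ DIM('a)) * emeasure lebesgue V"
    unfolding 1 by (intro nn_integral_cmult) simp
  finally show ?thesis .
qed

lemma measure_similarity_image_open:
  fixes \<Psi> :: "'a::euclidean_space \<Rightarrow> 'a"
  assumes "similarity r \<Psi>" "open V"
  shows "measure lebesgue (\<Psi> ` V) = r ^ DIM('a) * measure lebesgue V"
  using emeasure_similarity_image_open[OF assms] assms(1)
  by (simp add: measure_def enn2real_mult similarity_def)

lemma infdist_similarity:
  fixes \<Psi> :: "'a::euclidean_space \<Rightarrow> 'a"
  assumes "similarity r \<Psi>" "closed A" "A \<noteq> {}"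
  shows "infdist (\<Psi> x) (\<Psi> ` A) = r * infdist x A"
proof (rule antisym)
  have r: "r > 0" and D: "dist (\<Psi> x) (\<Psi> y) = r * dist x y" for x y
    using assms by (auto simp: similarity_def)
  obtain y where "y \<in> A" "infdist x A = dist x y"
    using infdist_attains_inf assms by blast
  then show "infdist (\<Psi> x) (\<Psi> ` A) \<le> r * infdist x A"
    using infdist_le[of "\<Psi> y" "\<Psi> ` A" "\<Psi> x"] D by auto
  have "infdist x A \<le> dist x a" if "a \<in> A" for a using that by (rule infdist_le)
  then have "r * infdist x A \<le> dist (\<Psi> x) b" if "b \<in> \<Psi> ` A" for b
    using that r D by auto
  then show "r * infdist x A \<le> infdist (\<Psi> x) (\<Psi> ` A)"
    unfolding infdist_def using assms(3) by (auto intro!: cINF_greatest)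
qed

lemma bounded_neq_UNIV: "bounded (A :: 'a::euclidean_space set) \<Longrightarrow> - A \<noteq> {}"
  using not_bounded_UNIV by (metis Compl_empty_eq double_compl)

lemma inner_parallel_eq_Diff: "inner_parallel A \<epsilon> = A - {x \<in> A. \<epsilon> < infdist x (- A)}"
  by (auto simp: inner_parallel_def)

lemma open_inner_core:
  assumes "open A" shows "open {x \<in> A. \<epsilon> < infdist x (- A)}"
proof -
  have "open {x. \<epsilon> < infdist x (- A)}"
    by (intro open_Collect_less continuous_intros)
  then show ?thesis using assms by (simp add: Collect_conj_eq open_Int)
qed

lemma inner_parallel_measurable [measurable]:
  assumes "open (A :: 'a::euclidean_space set)" shows "inner_parallel A \<epsilon> \<in> sets lebesgue"
  using assms open_inner_core[OF assms, of \<epsilon>] unfolding inner_parallel_eq_Diff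
  by (metis borel_open sets_completionI_sets sets_lborel sets.Diff)

lemma inner_volume_similarity:
  fixes \<Psi> :: "'a::euclidean_space \<Rightarrow> 'a"
  assumes sim: "similarity r \<Psi>" and G: "open G" "bounded G"
  shows "inner_volume (\<Psi> ` G) \<epsilon> = r ^ DIM('a) * inner_volume G (\<epsilon> / r)"
proof -
  have r: "r > 0" using sim by (auto simp: similarity_def)
  have bij: "bij \<Psi>" by (rule similarity_bij[OF sim])
  have [simp]: "\<Psi> x \<in> \<Psi> ` G \<longleftrightarrow> x \<in> G" for x
    using bij by (metis bij_is_inj inj_image_mem_iff)
  have comp: "- (\<Psi> ` G) = \<Psi> ` (- G)"
    using bij by (simp add: bij_image_Compl_eq)
  have inf: "infdist (\<Psi> x) (- (\<Psi> ` G)) = r * infdist x (- G)" for x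
    unfolding comp using G bounded_neq_UNIV
    by (intro infdist_similarity[OF sim]) auto
  define W where "W = {x \<in> G. \<epsilon> / r < infdist x (- G)}"
  have W: "open W" "W \<subseteq> G" using open_inner_core[OF G(1)] by (auto simp: W_def)
  have "{x \<in> \<Psi> ` G. \<epsilon> < infdist x (- (\<Psi> ` G))} = \<Psi> ` W"
    using r by (auto simp: W_def inf field_simps)
  then have "inner_parallel (\<Psi> ` G) \<epsilon> = \<Psi> ` G - \<Psi> ` W"
    unfolding inner_parallel_eq_Diff by simp
  have GL: "G \<in> lmeasurable" "W \<in> lmeasurable"
    using G W bounded_subset lmeasurable_open by blast+
  have bP: "bounded (\<Psi> ` X)" if X: "bounded X" for X
  proof -
    obtain B where "\<forall>x\<in>X. dist 0 x \<le> B" using X bounded_any_center by blast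
    then have "\<forall>y\<in>\<Psi> ` X. dist (\<Psi> 0) y \<le> r * B"
      using sim by (auto simp: similarity_def)
    then show ?thesis using bounded_any_center by blast
  qed
  have PGL: "\<Psi> ` G \<in> lmeasurable" "\<Psi> ` W \<in> lmeasurable"
    using bP G W bounded_subset lmeasurable_open similarity_image_open[OF sim] by metis+
  have "inner_volume (\<Psi> ` G) \<epsilon> = measure lebesgue (\<Psi> ` G) - measure lebesgue (\<Psi> ` W)"
    unfolding inner_volume_def \<open>inner_parallel (\<Psi> ` G) \<epsilon> = _\<close>
    using PGL W(2) by (intro measurable_measure_Diff) (auto simp: fmeasurableD)
  also have "\<dots> = r ^ DIM('a) * (measure lebesgue G - measure lebesgue W)"
    using measure_similarity_image_open[OF sim] G W by (simp add: algebra_simps)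
  also have "measure lebesgue G - measure lebesgue W = inner_volume G (\<epsilon> / r)"
    unfolding inner_volume_def inner_parallel_eq_Diff W_def[symmetric]
    using GL W(2) by (intro measurable_measure_Diff[symmetric]) (auto simp: fmeasurableD)
  finally show ?thesis .
qed

text \<open>A nearest point of the complement of one piece lies on its boundary, hence in no other
  piece; so the distance to the complement of the union is the same.\<close>

lemma infdist_Compl_UN_disjoint:
  fixes Gs :: "nat \<Rightarrow> 'a::euclidean_space set"
  assumes dj: "disjoint_family Gs" and op: "\<And>j. open (Gs j)" and ne: "- Gs j \<noteq> {}" and x: "x \<in> Gs j"
  shows "infdist x (- (\<Union>i. Gs i)) = infdist x (- Gs j)"
proof -
  obtain y where y: "y \<in> - Gs j" "infdist x (- Gs j) = dist x y"
    using infdist_attains_inf[of "- Gs j" x] op ne by (metis closed_Compl)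
  have "y \<notin> Gs i" for i
  proof
    assume yi: "y \<in> Gs i"
    then have "i \<noteq> j" using y by auto
    obtain e where e: "e > 0" "ball y e \<subseteq> Gs i" using op yi openE by blast
    have xy: "dist x y > 0" using x y by auto
    define t where "t = min (1/2) (e / (2 * dist x y))"
    have t: "0 < t" "t < 1" "t * dist x y < e"
      using e xy by (auto simp: t_def min_def field_simps)
    \<comment> \<open>Moving from \<open>y\<close> slightly towards \<open>x\<close> would stay inside piece \<open>i\<close>, but get closer to \<open>x\<close>.\<close>
    define z where "z = y + t *\<^sub>R (x - y)"
    have "dist y z = t * dist x y" using t by (simp add: z_def dist_norm norm_minus_commute)
    then have "z \<in> Gs i" using e t by auto
    then have "z \<in> - Gs j" using dj \<open>i \<noteq> j\<close> by (auto simp: disjoint_family_on_def)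
    then have "dist x y \<le> dist x z" using y infdist_le by metis
    moreover have "x - z = (1 - t) *\<^sub>R (x - y)" by (simp add: z_def algebra_simps)
    then have "dist x z = (1 - t) * dist x y" using t by (simp add: dist_norm)
    ultimately have "t * dist x y \<le> 0" by (simp add: algebra_simps)
    then show False using t xy by (simp add: mult_le_0_iff)
  qed
  then have yA: "y \<in> - (\<Union>i. Gs i)" by blast
  have "infdist x (- (\<Union>i. Gs i)) \<le> dist x y" using yA by (rule infdist_le)
  moreover have "infdist x (- Gs j) \<le> infdist x (- (\<Union>i. Gs i))"
    using yA by (intro infdist_mono) auto
  ultimately show ?thesis using y by simp
qed

text \<open>Summability of the \<open>d\<close>-th powers of the lengths makes the union have finite measure, so that
  the volumes of the pieces may be added. By scaling, the piece of size \<open>L j\<close> contributes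
  \<open>L j ^ d\<close> times the inner volume of the generator at \<open>\<epsilon> / L j\<close>.\<close>

lemma spray_volume_sums:
  fixes G :: "'a::euclidean_space set"
  assumes spray: "fractal_spray L G Gs" and summ: "summable (\<lambda>j. L j ^ DIM('a))"
  shows "(\<lambda>j. L j ^ DIM('a) * inner_volume G (\<epsilon> / L j)) sums spray_volume Gs \<epsilon>"
proof -
  have G: "open G" "bounded G" and Lpos: "\<And>j. L j > 0"
    and dj: "disjoint_family Gs" and Gs: "\<And>j. bounded (Gs j)" "\<And>j. open (Gs j)"
    using spray by (auto simp: fractal_spray_def fractal_string_def generator_def)
  obtain \<Psi> where \<Psi>: "\<And>j. similarity (L j) (\<Psi> j)" "\<And>j. Gs j = \<Psi> j ` G"
    using spray unfolding fractal_spray_def by metis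
  have meas: "measure lebesgue (Gs j) = L j ^ DIM('a) * measure lebesgue G" for j
    using measure_similarity_image_open[OF \<Psi>(1) G(1)] \<Psi>(2) by simp
  have fin: "emeasure lebesgue (Gs j) = ennreal (measure lebesgue (Gs j))" for j
    using lmeasurable_open[OF Gs] by (simp add: emeasure_eq_measure2)
  have "emeasure lebesgue (\<Union>j. Gs j) = (\<Sum>j. ennreal (measure lebesgue (Gs j)))"
    using dj Gs(2) by (subst suminf_emeasure[symmetric]) (auto simp: fin)
  also have "\<dots> = ennreal (\<Sum>j. measure lebesgue (Gs j))"
    using summ unfolding meas using Lpos
    by (intro suminf_ennreal2 summable_mult2) (auto simp: less_imp_le)
  finally have finU: "emeasure lebesgue (\<Union>j. Gs j) < \<infinity>" by simp
  define P where "P j = inner_parallel (Gs j) \<epsilon>" for j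
  have "inner_parallel (\<Union>j. Gs j) \<epsilon> = (\<Union>j. P j)"
    using infdist_Compl_UN_disjoint[OF dj Gs(2)] bounded_neq_UNIV[OF Gs(1)]
    by (auto simp: inner_parallel_def P_def)
  moreover have "(\<lambda>j. measure lebesgue (P j)) sums measure lebesgue (\<Union>j. P j)"
  proof (rule measure_UNION)
    show "range P \<subseteq> sets lebesgue"
      using Gs(2) inner_parallel_measurable by (auto simp: P_def)
    show "disjoint_family P"
      using dj unfolding disjoint_family_on_def P_def inner_parallel_def by blast
    have "(\<Union>j. P j) \<subseteq> (\<Union>j. Gs j)" by (auto simp: P_def inner_parallel_def)
    then have "emeasure lebesgue (\<Union>j. P j) \<le> emeasure lebesgue (\<Union>j. Gs j)"
      using Gs(2) by (intro emeasure_mono) auto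
    then show "emeasure lebesgue (\<Union>j. P j) \<noteq> \<infinity>" using finU by auto
  qed
  moreover have "measure lebesgue (P j) = L j ^ DIM('a) * inner_volume G (\<epsilon> / L j)" for j
    using inner_volume_similarity[OF \<Psi>(1) G] by (simp add: P_def \<Psi>(2) inner_volume_def)
  ultimately show ?thesis
    by (simp add: spray_volume_def inner_volume_def)
qed

lemma inradius_bounds:
  fixes G :: "'a::euclidean_space set"
  assumes "generator G"
  shows "inradius G > 0" and "x \<in> G \<Longrightarrow> infdist x (- G) \<le> inradius G"
proof -
  have G: "open G" "bounded G" "G \<noteq> {}" using assms by (auto simp: generator_def)
  define R where "R = {r. r > 0 \<and> (\<exists>x. ball x r \<subseteq> G)}"
  have bdd: "bdd_above R"
  proof (rule bdd_aboveI)
    fix r assume "r \<in> R"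
    then obtain x where "r > 0" "ball x r \<subseteq> G" by (auto simp: R_def)
    then have "diameter (ball x r) \<le> diameter G" using G(2) by (intro diameter_subset)
    then show "r \<le> diameter G" using \<open>r > 0\<close> by simp
  qed
  obtain x0 e where "e > 0" "ball x0 e \<subseteq> G" using G openE by (metis ex_in_conv)
  then have "e \<in> R" by (auto simp: R_def)
  then have "e \<le> Sup R" using bdd by (rule cSup_upper)
  then show pos: "inradius G > 0" using \<open>e > 0\<close> by (simp add: inradius_def R_def)
  show "infdist x (- G) \<le> inradius G" if "x \<in> G"
  proof (cases "infdist x (- G) > 0")
    case True
    have "ball x (infdist x (- G)) \<subseteq> G"
    proof
      fix y assume "y \<in> ball x (infdist x (- G))"
      then show "y \<in> G" using infdist_le[of y "- G" x] by (metis ComplI mem_ball not_le)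
    qed
    then have "infdist x (- G) \<in> R" using True by (auto simp: R_def)
    then show ?thesis unfolding inradius_def R_def[symmetric] using bdd by (rule cSup_upper)
  qed (use pos in auto)
qed

lemma inner_volume_eq_measure:
  assumes "generator G" "\<epsilon> \<ge> inradius G"
  shows "inner_volume G \<epsilon> = measure lebesgue G"
proof -
  have "inner_parallel G \<epsilon> = G"
    using inradius_bounds(2)[OF assms(1)] assms(2) by (force simp: inner_parallel_def)
  then show ?thesis by (simp add: inner_volume_def)
qed

text \<open>At \<open>\<epsilon>\<close> equal to the inradius the inner parallel set is the whole generator. This links its
  volume to the coefficients, and it is the reason why the two terms of the tubular zeta function
  combine into one kernel.\<close>

lemma monophase_at_inradius:
  fixes G :: "'a::euclidean_space set"
  assumes "generator G" "monophase_with G \<kappa>"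
  shows "measure lebesgue G = (\<Sum>k\<le>DIM('a). \<kappa> k * inradius G ^ (DIM('a) - k))"
  using inner_volume_eq_measure[OF assms(1), of "inradius G"] assms(2) inradius_bounds(1)[OF assms(1)]
  by (auto simp: monophase_with_def)

section \<open>Lipschitz functions on the real line\<close>

lemma emeasure_interval_measure_Ioo:
  fixes F :: "real \<Rightarrow> real"
  assumes "a \<le> b" and mono: "\<And>x y. x \<le> y \<Longrightarrow> F x \<le> F y" and cont: "continuous_on UNIV F"
  shows "emeasure (interval_measure F) {a<..<b} = ennreal (F b - F a)"
proof (cases "a = b")
  case False
  have 0: "{b} \<in> null_sets (interval_measure F)"
    using emeasure_interval_measure_Icc[of b b F] mono cont by (auto simp: null_sets_def)
  have "emeasure (interval_measure F) {a<..<b} = emeasure (interval_measure F) ({a<..<b} \<union> {b})"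
    using 0 by (intro emeasure_Un_null_set[symmetric]) auto
  also have "{a<..<b} \<union> {b} = {a<..b}" using False assms(1) by auto
  also have "emeasure (interval_measure F) {a<..b} = ennreal (F b - F a)"
    using cont assms(1) mono
    by (intro emeasure_interval_measure_Ioc) (auto simp: continuous_on_eq_continuous_at intro: continuous_at_imp_continuous_at_within)
  finally show ?thesis .
qed simp

text \<open>After adding a linear function and rescaling, a Lipschitz function and its counterpart with
  the opposite sign give two monotone functions whose sum is the identity. Their Stieltjes measures
  add up to Lebesgue measure, so the first is absolutely continuous and has a density; the Lebesgue
  differentiation theorem then identifies the density with the derivative almost everywhere. Its
  version for right-hand intervals is applied once to the density and once to its reflection, which
  gives both one-sided derivatives.\<close>

lemma lipschitz_ae_derivative:
  fixes \<phi> :: "real \<Rightarrow> real"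
  assumes lip: "K-lipschitz_on UNIV \<phi>"
  obtains \<rho> N where "\<rho> \<in> borel_measurable borel" "negligible N"
    "\<And>t. t \<notin> N \<Longrightarrow> (\<phi> has_real_derivative \<rho> t) (at t)"
    "\<And>a b. a \<le> b \<Longrightarrow> (\<rho> has_integral \<phi> b - \<phi> a) {a..b}"
proof -
  define C where "C = K + 1"
  have C: "C > 0" using lipschitz_on_nonneg[OF lip] by (simp add: C_def)
  have cont: "continuous_on UNIV \<phi>" using lip lipschitz_on_continuous_on by blast
  have bnd: "\<bar>\<phi> y - \<phi> x\<bar> \<le> C * (y - x)" if "x \<le> y" for x y
  proof -
    have "\<bar>\<phi> y - \<phi> x\<bar> \<le> K * (y - x)"
      using lipschitz_onD[OF lip, of y x] that by (simp add: dist_real_def)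
    also have "\<dots> \<le> C * (y - x)" using that by (intro mult_right_mono) (auto simp: C_def)
    finally show ?thesis .
  qed
  define H1 where "H1 t = (C * t + \<phi> t) / (2 * C)" for t
  define H2 where "H2 t = (C * t - \<phi> t) / (2 * C)" for t
  have mono: "H1 x \<le> H1 y" "H2 x \<le> H2 y" if "x \<le> y" for x y
  proof -
    have "\<bar>\<phi> y - \<phi> x\<bar> \<le> C * y - C * x"
      using bnd[OF that] by (simp only: right_diff_distrib)
    then have "C * x + \<phi> x \<le> C * y + \<phi> y" "C * x - \<phi> x \<le> C * y - \<phi> y"
      by linarith+
    then show "H1 x \<le> H1 y" "H2 x \<le> H2 y"
      unfolding H1_def H2_def using C by (intro divide_right_mono; simp)+
  qed
  have contH: "isCont H1 x" "isCont H2 x" for x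
  proof -
    have "isCont \<phi> x" using cont continuous_on_eq_continuous_at open_UNIV by blast
    moreover have "2 * C \<noteq> 0" using C by simp
    ultimately show "isCont H1 x" "isCont H2 x"
      unfolding H1_def H2_def
      by (simp_all add: continuous_intros)
  qed
  define M1 where "M1 = interval_measure H1"
  define M2 where "M2 = interval_measure H2"
  have sM [measurable_cong, simp]: "sets M1 = sets borel" "sets M2 = sets borel"
    by (simp_all add: M1_def M2_def)
  define M where "M = measure_of UNIV (sets borel) (\<lambda>A. emeasure M1 A + emeasure M2 A)"
  have sMM [simp]: "sets M = sets borel" "space M = UNIV"
    using sets.sigma_sets_eq[of "borel :: real measure"] by (simp_all add: M_def)
  have eM: "emeasure M A = emeasure M1 A + emeasure M2 A" if "A \<in> sets borel" for A
  proof (rule emeasure_measure_of[OF M_def])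
    show "countably_additive (sets M) (\<lambda>A. emeasure M1 A + emeasure M2 A)"
      unfolding countably_additive_def
    proof (intro allI impI)
      fix F :: "nat \<Rightarrow> real set"
      assume F: "range F \<subseteq> sets M" "disjoint_family F"
      have "(\<Sum>i. emeasure M1 (F i) + emeasure M2 (F i)) = (\<Sum>i. emeasure M1 (F i)) + (\<Sum>i. emeasure M2 (F i))"
        by (intro suminf_add[symmetric]) auto
      then show "(\<Sum>i. emeasure M1 (F i) + emeasure M2 (F i)) = emeasure M1 (\<Union>i. F i) + emeasure M2 (\<Union>i. F i)"
        using F by (simp add: suminf_emeasure)
    qed
  qed (use that in \<open>auto simp: positive_def\<close>)
  have Ioo: "emeasure M1 {a<..<b} = ennreal (H1 b - H1 a)" "emeasure M2 {a<..<b} = ennreal (H2 b - H2 a)"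
    if "a \<le> b" for a b
    unfolding M1_def M2_def using that mono contH
    by (intro emeasure_interval_measure_Ioo continuous_at_imp_continuous_on ballI; blast)+
  have "lborel = M"
  proof (rule lborel_eqI)
    fix l u :: real assume "\<And>b. b \<in> Basis \<Longrightarrow> l \<bullet> b \<le> u \<bullet> b"
    then have lu: "l \<le> u" by simp
    have eq: "(H1 u - H1 l) + (H2 u - H2 l) = u - l"
      using C by (simp add: H1_def H2_def field_simps)
    have "emeasure M (box l u) = ennreal ((H1 u - H1 l) + (H2 u - H2 l))"
      using lu mono[OF lu] by (simp add: eM Ioo box_real ennreal_plus)
    then show "emeasure M (box l u) = ennreal (\<Prod>b\<in>Basis. (u - l) \<bullet> b)"
      unfolding eq by simp
  qed simp
  then have le: "emeasure M1 A \<le> emeasure lborel A" if "A \<in> sets borel" for A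
    unfolding \<open>lborel = M\<close> eM[OF that] by simp
  have "absolutely_continuous lborel M1"
    unfolding absolutely_continuous_def
  proof
    fix A assume A: "A \<in> null_sets (lborel :: real measure)"
    then have "A \<in> sets borel" "emeasure lborel A = 0" by (auto simp: null_sets_def)
    then show "A \<in> null_sets M1" using le[of A] by (auto simp: null_sets_def)
  qed
  then obtain f where f: "f \<in> borel_measurable lborel" "density lborel f = M1"
    using sigma_finite_measure.Radon_Nikodym[OF lborel.sigma_finite_measure_axioms, of M1] by auto
  have f' [measurable]: "f \<in> borel_measurable borel" using f by simp
  define \<rho>0 where "\<rho>0 x = enn2real (f x)" for x
  have int0: "(\<rho>0 has_integral H1 b - H1 a) {a..b}" if "a \<le> b" for a b
  proof -
    have "(\<integral>\<^sup>+x. f x * indicator {a<..<b} x \<partial>lborel) = emeasure M1 {a<..<b}"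
      unfolding f(2)[symmetric] by (subst emeasure_density) auto
    then have I: "(\<integral>\<^sup>+x. f x * indicator {a<..<b} x \<partial>lborel) = ennreal (H1 b - H1 a)"
      using Ioo that by simp
    then have "AE x in lborel. f x * indicator {a<..<b} x \<noteq> \<infinity>"
      by (intro nn_integral_PInf_AE) auto
    then have AE: "AE x in lborel. ennreal (\<rho>0 x * indicator {a<..<b} x) = f x * indicator {a<..<b} x"
      by eventually_elim (auto simp: \<rho>0_def indicator_def less_top)
    have "has_bochner_integral lborel (\<lambda>x. \<rho>0 x * indicator {a<..<b} x) (H1 b - H1 a)"
    proof (rule has_bochner_integral_nn_integral)
      show "(\<integral>\<^sup>+x. ennreal (\<rho>0 x * indicator {a<..<b} x) \<partial>lborel) = ennreal (H1 b - H1 a)"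
        unfolding I[symmetric] using AE by (intro nn_integral_cong_AE)
    qed (use mono[OF that] in \<open>auto simp: \<rho>0_def\<close>)
    then have "((\<lambda>x. \<rho>0 x * indicator {a<..<b} x) has_integral H1 b - H1 a) UNIV"
      using has_integral_integral_lborel has_bochner_integral_iff by metis
    then have "((\<lambda>x. if x \<in> {a<..<b} then \<rho>0 x else 0) has_integral H1 b - H1 a) UNIV"
      by (rule has_integral_eq[rotated]) (auto simp: indicator_def)
    then have "(\<rho>0 has_integral H1 b - H1 a) {a<..<b}"
      by (simp only: has_integral_restrict_UNIV)
    then show ?thesis by (simp add: has_integral_Icc_iff_Ioo)
  qed
  define \<rho> where "\<rho> x = 2 * C * \<rho>0 x - C" for x
  have meas: "\<rho> \<in> borel_measurable borel" unfolding \<rho>_def \<rho>0_def by measurable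
  have int: "(\<rho> has_integral \<phi> b - \<phi> a) {a..b}" if "a \<le> b" for a b
  proof -
    have "(\<rho> has_integral 2 * C * (H1 b - H1 a) - measure lborel {a..b} *\<^sub>R C) {a..b}"
      unfolding \<rho>_def
      by (intro has_integral_diff has_integral_mult_right int0 that has_integral_const_real)
    moreover have "2 * C * (H1 b - H1 a) - measure lborel {a..b} *\<^sub>R C = \<phi> b - \<phi> a"
      using C that by (simp add: H1_def field_simps)
    ultimately show ?thesis by simp
  qed
  have int': "((\<lambda>x. \<rho> (- x)) has_integral \<phi> (- a) - \<phi> (- b)) {a..b}" if "a \<le> b" for a b
    using int[of "- b" "- a"] that has_integral_reflect_real[where f = \<rho> and a = "- b" and b = "- a"]
    by (metis minus_minus neg_le_iff_le)
  have int_able: "\<rho> integrable_on cbox a b" for a b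
    using int[of a b] by (cases "a \<le> b") (auto simp: has_integral_integrable)
  obtain N1 where N1: "negligible N1"
     "\<And>x e. \<lbrakk>x \<notin> N1; 0 < e\<rbrakk> \<Longrightarrow> \<exists>d>0. \<forall>h. 0 < h \<and> h < d \<longrightarrow>
                 norm (integral (cbox x (x + h *\<^sub>R One)) \<rho> /\<^sub>R h ^ DIM(real) - \<rho> x) < e"
    using integrable_ccontinuous_explicit[OF int_able] by blast
  have int_r_able: "(\<lambda>x. \<rho> (- x)) integrable_on cbox a b" for a b
    using int'[of a b] by (cases "a \<le> b") (auto simp: has_integral_integrable)
  obtain N2 where N2: "negligible N2"
     "\<And>x e. \<lbrakk>x \<notin> N2; 0 < e\<rbrakk> \<Longrightarrow> \<exists>d>0. \<forall>h. 0 < h \<and> h < d \<longrightarrow>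
                 norm (integral (cbox x (x + h *\<^sub>R One)) (\<lambda>x. \<rho> (- x)) /\<^sub>R h ^ DIM(real) - \<rho> (- x)) < e"
    using integrable_ccontinuous_explicit[OF int_r_able] by blast
  define N where "N = N1 \<union> uminus ` N2"
  have "negligible (uminus ` N2)"
  proof (rule negligible_locally_Lipschitz_image[OF _ N2(1)])
    show "\<exists>T B. open T \<and> x \<in> T \<and> (\<forall>y\<in>N2 \<inter> T. norm (- y - - x) \<le> B * norm (y - x))" for x
      by (intro exI[of _ UNIV] exI[of _ 1]) (auto simp: norm_minus_commute)
  qed simp
  then have N: "negligible N" using N1(1) by (simp add: N_def)
  have der: "(\<phi> has_real_derivative \<rho> t) (at t)" if "t \<notin> N" for t
    unfolding has_field_derivative_iff LIM_eq
  proof (intro allI impI)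
    fix e :: real assume e: "0 < e"
    have t1: "t \<notin> N1" and t2: "- t \<notin> N2" using that by (force simp: N_def)+
    obtain d1 where d1: "d1 > 0" "\<And>h. 0 < h \<Longrightarrow> h < d1 \<Longrightarrow> \<bar>(\<phi> (t + h) - \<phi> t) / h - \<rho> t\<bar> < e"
    proof -
      from N1(2)[OF t1 e] obtain d1 where d1: "d1 > 0" "\<And>h. 0 < h \<Longrightarrow> h < d1 \<Longrightarrow>
        norm (integral (cbox t (t + h *\<^sub>R One)) \<rho> /\<^sub>R h ^ DIM(real) - \<rho> t) < e" by blast
      have "\<bar>(\<phi> (t + h) - \<phi> t) / h - \<rho> t\<bar> < e" if "0 < h" "h < d1" for h
        using d1(2)[OF that] integral_unique[OF int[of t "t + h"]] that
        by (simp add: divide_inverse mult.commute)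
      then show ?thesis using that d1(1) by blast
    qed
    obtain d2 where d2: "d2 > 0" "\<And>h. 0 < h \<Longrightarrow> h < d2 \<Longrightarrow> \<bar>(\<phi> t - \<phi> (t - h)) / h - \<rho> t\<bar> < e"
    proof -
      from N2(2)[OF t2 e] obtain d1 where d1: "d1 > 0" "\<And>h. 0 < h \<Longrightarrow> h < d1 \<Longrightarrow>
        norm (integral (cbox (- t) (- t + h *\<^sub>R One)) (\<lambda>x. \<rho> (- x)) /\<^sub>R h ^ DIM(real) - \<rho> (- (- t))) < e" by blast
      have "\<bar>(\<phi> t - \<phi> (t - h)) / h - \<rho> t\<bar> < e" if "0 < h" "h < d1" for h
        using d1(2)[OF that] integral_unique[OF int'[of "- t" "- t + h"]] that
        by (simp add: divide_inverse mult.commute)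
      then show ?thesis using that d1(1) by blast
    qed
    have "norm ((\<phi> x - \<phi> t) / (x - t) - \<rho> t) < e" if x: "x \<noteq> t" "norm (x - t) < min d1 d2" for x
    proof (cases "x > t")
      case True
      then show ?thesis using d1(2)[of "x - t"] x by simp
    next
      case False
      then have "\<bar>(\<phi> t - \<phi> x) / (t - x) - \<rho> t\<bar> < e" using d2(2)[of "t - x"] x by simp
      moreover have "(\<phi> t - \<phi> x) / (t - x) = (\<phi> x - \<phi> t) / (x - t)"
        by (metis minus_diff_eq minus_divide_divide)
      ultimately show ?thesis by simp
    qed
    then show "\<exists>s>0. \<forall>x. x \<noteq> t \<and> norm (x - t) < s \<longrightarrow> norm ((\<phi> x - \<phi> t) / (x - t) - \<rho> t) < e"
      using d1 d2 by (intro exI[of _ "min d1 d2"]) auto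
  qed
  show ?thesis using that[OF meas N der int] by blast
qed

text \<open>The fundamental theorem of calculus for a Lipschitz function, for any version of its
  almost everywhere derivative.\<close>

lemma has_integral_lipschitz_derivative_real:
  fixes \<phi> :: "real \<Rightarrow> real"
  assumes lip: "K-lipschitz_on {a..b} \<phi>" and ab: "a \<le> b" and N: "negligible N"
    and der: "\<And>t. t \<in> {a<..<b} - N \<Longrightarrow> (\<phi> has_real_derivative \<phi>' t) (at t)"
  shows "(\<phi>' has_integral \<phi> b - \<phi> a) {a..b}"
proof -
  \<comment> \<open>Clamping to \<open>{a..b}\<close> extends \<open>\<phi>\<close> to the line with the same Lipschitz constant.\<close>
  define p where "p t = max a (min b t)" for t
  define \<psi> where "\<psi> t = \<phi> (p t)" for t
  have p: "p t \<in> {a..b}" "dist (p s) (p t) \<le> dist s t" for s t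
    using ab by (auto simp: p_def dist_real_def)
  have "K-lipschitz_on UNIV \<psi>"
  proof (rule lipschitz_onI)
    show "dist (\<psi> x) (\<psi> y) \<le> K * dist x y" for x y
      using lipschitz_onD[OF lip p(1) p(1), of x y] mult_left_mono[OF p(2) lipschitz_on_nonneg[OF lip], of x y]
      by (simp add: \<psi>_def)
  qed (use lipschitz_on_nonneg[OF lip] in auto)
  then obtain \<rho> N' where \<rho>: "negligible N'" "\<And>t. t \<notin> N' \<Longrightarrow> (\<psi> has_real_derivative \<rho> t) (at t)"
    "\<And>a b. a \<le> b \<Longrightarrow> (\<rho> has_integral \<psi> b - \<psi> a) {a..b}"
    using lipschitz_ae_derivative by metis
  have eq: "\<phi>' t = \<rho> t" if "t \<in> {a..b} - (N \<union> N' \<union> {a, b})" for t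
  proof -
    have t: "t \<in> {a<..<b}" using that by auto
    have "(\<phi> has_real_derivative \<rho> t) (at t)"
      using t that by (intro has_field_derivative_transform_within_open[OF \<rho>(2), of t "{a<..<b}"])
         (auto simp: \<psi>_def p_def)
    then show ?thesis using der[of t] t that DERIV_unique by blast
  qed
  have int: "(\<rho> has_integral \<phi> b - \<phi> a) {a..b}"
    using \<rho>(3)[OF ab] ab by (simp add: \<psi>_def p_def)
  show ?thesis
  proof (rule has_integral_spike[OF _ _ int])
    show "negligible (N \<union> N' \<union> {a, b})" using N \<rho>(1) by (intro negligible_Un) auto
  qed (rule eq)
qed

lemma has_integral_lipschitz_derivative:
  fixes \<phi> :: "real \<Rightarrow> 'b::euclidean_space"
  assumes lip: "K-lipschitz_on {a..b} \<phi>" and ab: "a \<le> b" and N: "negligible N"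
    and der: "\<And>t. t \<in> {a<..<b} - N \<Longrightarrow> (\<phi> has_vector_derivative \<phi>' t) (at t)"
  shows "(\<phi>' has_integral \<phi> b - \<phi> a) {a..b}"
  unfolding has_integral_componentwise_iff[of \<phi>']
proof
  fix i :: 'b assume i: "i \<in> Basis"
  have "((\<lambda>t. \<phi>' t \<bullet> i) has_integral \<phi> b \<bullet> i - \<phi> a \<bullet> i) {a..b}"
  proof (rule has_integral_lipschitz_derivative_real[OF _ ab N])
    show "K-lipschitz_on {a..b} (\<lambda>t. \<phi> t \<bullet> i)"
    proof (rule lipschitz_onI)
      fix x y assume "x \<in> {a..b}" "y \<in> {a..b}"
      then have "norm (\<phi> x - \<phi> y) \<le> K * dist x y"
        using lipschitz_onD[OF lip] by (simp add: dist_norm)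
      moreover have "\<bar>(\<phi> x - \<phi> y) \<bullet> i\<bar> \<le> norm (\<phi> x - \<phi> y)"
        using i by (rule Basis_le_norm)
      ultimately show "dist (\<phi> x \<bullet> i) (\<phi> y \<bullet> i) \<le> K * dist x y"
        by (simp add: dist_real_def inner_diff_left)
    qed (use lipschitz_on_nonneg[OF lip] in auto)
    fix t assume "t \<in> {a<..<b} - N"
    from bounded_linear.has_vector_derivative[OF bounded_linear_inner_left der[OF this]]
    show "((\<lambda>t. \<phi> t \<bullet> i) has_real_derivative \<phi>' t \<bullet> i) (at t)"
      by (simp add: has_real_derivative_iff_has_vector_derivative)
  qed
  then show "((\<lambda>t. \<phi>' t \<bullet> i) has_integral (\<phi> b - \<phi> a) \<bullet> i) {a..b}"
    by (simp add: inner_diff_left)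
qed

text \<open>At points without derivative \<open>deriv\<close> has an arbitrary value, so the bound and the
  differentiability hold only off a null set; measurability is unaffected.\<close>

lemma lipschitz_deriv_ae:
  fixes S :: "real \<Rightarrow> real"
  assumes lip: "K-lipschitz_on UNIV S"
  obtains N where "negligible N" "\<And>t. t \<notin> N \<Longrightarrow> (S has_real_derivative deriv S t) (at t)"
    "\<And>t. t \<notin> N \<Longrightarrow> \<bar>deriv S t\<bar> \<le> K" "deriv S \<in> borel_measurable lebesgue"
proof -
  obtain \<rho> N where \<rho>: "\<rho> \<in> borel_measurable borel" "negligible N"
    "\<And>t. t \<notin> N \<Longrightarrow> (S has_real_derivative \<rho> t) (at t)"
    using lipschitz_ae_derivative[OF lip] by metis
  have eq: "deriv S t = \<rho> t" if "t \<notin> N" for t using \<rho>(3)[OF that] by (rule DERIV_imp_deriv)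
  have K: "\<bar>\<rho> t\<bar> \<le> K" if "t \<notin> N" for t
  proof -
    have "((\<lambda>x. \<bar>(S x - S t) / (x - t)\<bar>) \<longlongrightarrow> \<bar>\<rho> t\<bar>) (at t)"
      using \<rho>(3)[OF that] by (intro tendsto_rabs) (simp add: has_field_derivative_iff)
    then show ?thesis
    proof (rule tendsto_upperbound)
      have "\<bar>(S x - S t) / (x - t)\<bar> \<le> K" if "x \<noteq> t" for x
        using lipschitz_onD[OF lip, of x t] that by (simp add: dist_real_def divide_simps)
      then show "\<forall>\<^sub>F x in at t. \<bar>(S x - S t) / (x - t)\<bar> \<le> K"
        by (auto simp: eventually_at_filter)
    qed simp
  qed
  have "deriv S \<in> borel_measurable lebesgue"
  proof (rule borel_measurable_AE)
    show "\<rho> \<in> borel_measurable lebesgue" using \<rho>(1) by (intro measurable_completion) simp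
    show "AE t in lebesgue. \<rho> t = deriv S t"
    proof (rule AE_I')
      show "N \<in> null_sets lebesgue" using \<rho>(2) by (simp add: negligible_iff_null_sets)
      show "{t \<in> space lebesgue. \<rho> t \<noteq> deriv S t} \<subseteq> N" using eq by fastforce
    qed
  qed
  show ?thesis using that[of N] \<rho> eq K \<open>deriv S \<in> borel_measurable lebesgue\<close> by auto
qed

section \<open>Residues to the right of a screen\<close>

text \<open>The residue theorem for a rectangle, with its four sides written out. The singularities need
  only be sparse in \<open>U\<close>: a slightly larger rectangle still lies in \<open>U\<close> and contains finitely many of
  them.\<close>

lemma rectangle_residues:
  fixes f :: "complex \<Rightarrow> complex"
  assumes U: "open U" and P: "P sparse_in U" and holo: "f holomorphic_on U - P"
    and x: "x0 < x1" and y: "y0 < y1"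
    and sub: "cbox (Complex x0 y0) (Complex x1 y1) \<subseteq> U"
    and bd: "P \<inter> (cbox (Complex x0 y0) (Complex x1 y1) - box (Complex x0 y0) (Complex x1 y1)) = {}"
  defines "R \<equiv> P \<inter> box (Complex x0 y0) (Complex x1 y1)"
  shows "finite R"
    and "contour_integral (linepath (Complex x0 y0) (Complex x1 y0)) f
       + contour_integral (linepath (Complex x1 y0) (Complex x1 y1)) f
       - contour_integral (linepath (Complex x0 y1) (Complex x1 y1)) f
       - contour_integral (linepath (Complex x0 y0) (Complex x0 y1)) f
       = 2 * of_real pi * \<i> * (\<Sum>p\<in>R. residue f p)" (is "?L = _")
proof -
  define z w where "z = Complex x0 y0" and "w = Complex x1 y1"
  obtain e where e: "e > 0" "(\<Union>q\<in>cbox z w. ball q e) \<subseteq> U"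
    using compact_subset_open_imp_ball_epsilon_subset[OF compact_cbox U] sub
    unfolding z_def w_def by blast
  define \<delta> where "\<delta> = e / 3"
  have \<delta>: "\<delta> > 0" "2 * \<delta> < e" using e by (auto simp: \<delta>_def)
  define z' w' where "z' = Complex (x0 - \<delta>) (y0 - \<delta>)" and "w' = Complex (x1 + \<delta>) (y1 + \<delta>)"
  have KU: "cbox z' w' \<subseteq> U"
  proof
    fix p assume p: "p \<in> cbox z' w'"
    define q where "q = Complex (max x0 (min x1 (Re p))) (max y0 (min y1 (Im p)))"
    have q: "q \<in> cbox z w" using x y by (auto simp: q_def z_def w_def in_cbox_complex_iff)
    have "\<bar>Re (q - p)\<bar> \<le> \<delta>" "\<bar>Im (q - p)\<bar> \<le> \<delta>"
      using p x y \<delta> by (auto simp: q_def z'_def w'_def in_cbox_complex_iff)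
    then have "cmod (q - p) < e" using cmod_le[of "q - p"] \<delta> by linarith
    then have "p \<in> ball q e" by (simp add: dist_norm)
    then show "p \<in> U" using e q by blast
  qed
  have fin: "finite (P \<inter> cbox z' w')"
    using sparse_in_compact_finite[of P "cbox z' w'"] sparse_in_subset[OF P KU] by (simp add: Int_commute)
  define B where "B = box z' w'"
  have BK: "B \<subseteq> cbox z' w'" by (simp add: B_def box_subset_cbox)
  have finB: "finite (P \<inter> B)" using fin BK by (meson finite_subset inf_mono order_refl)
  have zwB: "cbox z w \<subseteq> B"
    using \<delta> by (auto simp: B_def z_def w_def z'_def w'_def in_cbox_complex_iff in_box_complex_iff)
  show finR: "finite R"
    using finB zwB box_subset_cbox[of z w] unfolding R_def z_def[symmetric] w_def[symmetric]
    by (meson finite_subset inf_mono order_refl order_trans)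
  have holoB: "f holomorphic_on B - (P \<inter> B)"
    using holo by (rule holomorphic_on_subset) (use BK KU in blast)
  have PI: "path_image (rectpath z w) \<subseteq> cbox z w - P"
    using bd x y path_image_rectpath_cbox_minus_box[of z w]
    unfolding z_def[symmetric] w_def[symmetric] by (auto simp: z_def w_def)
  have "contour_integral (rectpath z w) f
      = 2 * pi * \<i> * (\<Sum>p\<in>P \<inter> B. winding_number (rectpath z w) p * residue f p)"
  proof (rule Residue_theorem[OF _ _ finB holoB])
    show "\<forall>p. p \<notin> B \<longrightarrow> winding_number (rectpath z w) p = 0"
      using zwB x y by (auto intro!: winding_number_rectpath_outside simp: z_def w_def)
  qed (use PI zwB in \<open>auto simp: B_def convex_connected\<close>)
  also have "(\<Sum>p\<in>P \<inter> B. winding_number (rectpath z w) p * residue f p)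
           = (\<Sum>p\<in>R. winding_number (rectpath z w) p * residue f p)"
  proof (rule sum.mono_neutral_right[OF finB])
    show "R \<subseteq> P \<inter> B" using zwB box_subset_cbox[of z w] by (auto simp: R_def z_def w_def)
    show "\<forall>p\<in>P \<inter> B - R. winding_number (rectpath z w) p * residue f p = 0"
    proof
      fix p assume "p \<in> P \<inter> B - R"
      then have "p \<notin> cbox z w" using bd by (auto simp: R_def z_def w_def)
      then show "winding_number (rectpath z w) p * residue f p = 0"
        using winding_number_rectpath_outside[of z w p] x y by (simp add: z_def w_def)
    qed
  qed
  also have "\<dots> = (\<Sum>p\<in>R. residue f p)"
    by (intro sum.cong) (auto simp: R_def winding_number_rectpath z_def w_def)
  finally have main: "contour_integral (rectpath z w) f = 2 * pi * \<i> * (\<Sum>p\<in>R. residue f p)" .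
  define z2 z4 where "z2 = Complex x1 y0" and "z4 = Complex x0 y1"
  have segs: "closed_segment z z2 \<subseteq> U - P" "closed_segment z2 w \<subseteq> U - P"
    "closed_segment w z4 \<subseteq> U - P" "closed_segment z4 z \<subseteq> U - P"
    using PI sub unfolding rectpath_def Let_def
    by (auto simp: path_image_join z_def w_def z2_def z4_def)
  have cont: "continuous_on (closed_segment u v) f" if "closed_segment u v \<subseteq> U - P" for u v
    using holo that by (meson continuous_on_subset holomorphic_on_imp_continuous_on)
  note ci = contour_integrable_continuous_linepath[OF cont]
  have "contour_integral (rectpath z w) f
     = contour_integral (linepath z z2) f + (contour_integral (linepath z2 w) f
     + (contour_integral (linepath w z4) f + contour_integral (linepath z4 z) f))"
    unfolding rectpath_def Let_def using ci[OF segs(1)] ci[OF segs(2)] ci[OF segs(3)] ci[OF segs(4)]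
    by (simp add: z_def w_def z2_def z4_def)
  also have "contour_integral (linepath w z4) f = - contour_integral (linepath z4 w) f"
    using cont segs(3) by (intro contour_integral_reverse_linepath) (simp add: closed_segment_commute)
  also have "contour_integral (linepath z4 z) f = - contour_integral (linepath z z4) f"
    using cont segs(4) by (intro contour_integral_reverse_linepath) (simp add: closed_segment_commute)
  finally show "?L = 2 * of_real pi * \<i> * (\<Sum>p\<in>R. residue f p)"
    using main by (simp add: z_def w_def z2_def z4_def algebra_simps)
qed

text \<open>The screen is only Lipschitz, so it is not a valid path. Where a primitive is available, the
  integral along it is nevertheless the difference of the end values.\<close>

lemma screen_integrand_primitive:
  assumes lip: "K-lipschitz_on UNIV S" and ab: "a \<le> b"
    and F: "\<And>z. z \<in> ball z0 r \<Longrightarrow> (F has_field_derivative f z) (at z)"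
    and sub: "\<And>t. t \<in> {a..b} \<Longrightarrow> Complex (S t) t \<in> cball z0 r'" and "r' < r"
  shows "(screen_integrand S f has_integral F (Complex (S b) b) - F (Complex (S a) a)) {a..b}"
proof -
  define \<gamma> where "\<gamma> t = Complex (S t) t" for t
  obtain N where N: "negligible N" "\<And>t. t \<notin> N \<Longrightarrow> (S has_real_derivative deriv S t) (at t)"
    using lipschitz_deriv_ae[OF lip] by metis
  have cb: "cball z0 r' \<subseteq> ball z0 r" using \<open>r' < r\<close> by auto
  have "f holomorphic_on ball z0 r"
    using F by (metis (no_types, lifting) DERIV_imp_deriv derivative_is_holomorphic open_ball)
  then have "continuous_on (cball z0 r') f"
    using cb by (meson continuous_on_subset holomorphic_on_imp_continuous_on)
  then have "bounded (f ` cball z0 r')"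
    by (intro compact_imp_bounded compact_continuous_image compact_cball)
  then obtain M where "M > 0" and M': "\<forall>w\<in>f ` cball z0 r'. norm w \<le> M"
    unfolding bounded_pos by blast
  have M: "norm (f z) \<le> M" if "z \<in> cball z0 r'" for z
    using M' that by blast
  have Fw: "(F has_field_derivative f z) (at z within cball z0 r')" if "z \<in> cball z0 r'" for z
    by (rule has_field_derivative_at_within, rule F) (use cb that in blast)
  have Flip: "norm (F z - F w) \<le> M * norm (z - w)" if "z \<in> cball z0 r'" "w \<in> cball z0 r'" for z w
    using field_differentiable_bound[where S = "cball z0 r'" and f = F and f' = f and B = M and x = z and y = w]
      Fw M that convex_cball by blast
  have \<gamma>lip: "norm (\<gamma> s - \<gamma> t) \<le> (K + 1) * dist s t" for s t
  proof -
    have "norm (\<gamma> s - \<gamma> t) \<le> \<bar>S s - S t\<bar> + \<bar>s - t\<bar>"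
      using cmod_le[of "\<gamma> s - \<gamma> t"] by (simp add: \<gamma>_def)
    also have "\<bar>S s - S t\<bar> \<le> K * dist s t"
      using lipschitz_onD[OF lip, of s t] by (simp add: dist_real_def)
    finally show ?thesis by (simp add: dist_real_def algebra_simps)
  qed
  have K: "K \<ge> 0" using lipschitz_on_nonneg[OF lip] .
  have "((\<lambda>t. f (\<gamma> t) * (of_real (deriv S t) + \<i>)) has_integral F (\<gamma> b) - F (\<gamma> a)) {a..b}"
  proof (rule has_integral_lipschitz_derivative[OF _ ab N(1)])
    show "(M * (K + 1))-lipschitz_on {a..b} (\<lambda>t. F (\<gamma> t))"
    proof (rule lipschitz_onI)
      fix s t assume "s \<in> {a..b}" "t \<in> {a..b}"
      then have "norm (F (\<gamma> s) - F (\<gamma> t)) \<le> M * norm (\<gamma> s - \<gamma> t)"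
        using sub by (intro Flip) (auto simp: \<gamma>_def)
      also have "\<dots> \<le> M * ((K + 1) * dist s t)"
        using \<gamma>lip \<open>M > 0\<close> by (intro mult_left_mono) auto
      finally show "dist (F (\<gamma> s)) (F (\<gamma> t)) \<le> M * (K + 1) * dist s t"
        by (simp add: dist_norm mult.assoc)
    qed (use K \<open>M > 0\<close> in auto)
    fix t assume t: "t \<in> {a<..<b} - N"
    have "(\<gamma> has_vector_derivative of_real (deriv S t) + \<i>) (at t)"
    proof -
      have "\<gamma> = (\<lambda>t. of_real (S t) + of_real t * \<i>)"
        by (auto simp: \<gamma>_def complex_eq_iff)
      moreover have "((\<lambda>t. of_real (S t) + of_real t * \<i>) has_vector_derivative of_real (deriv S t) + of_real 1 * \<i>) (at t)"
        using N(2)[of t] t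
        by (intro has_vector_derivative_add has_vector_derivative_mult_left has_vector_derivative_of_real DERIV_ident)
           (auto simp: has_real_derivative_iff_has_vector_derivative)
      ultimately show ?thesis by simp
    qed
    moreover have "(F has_field_derivative f (\<gamma> t)) (at (\<gamma> t))"
      using F sub[of t] cb t by (auto simp: \<gamma>_def)
    ultimately have "((F \<circ> \<gamma>) has_vector_derivative (of_real (deriv S t) + \<i>) * f (\<gamma> t)) (at t)"
      by (rule field_vector_diff_chain_at)
    then show "((\<lambda>t. F (\<gamma> t)) has_vector_derivative f (\<gamma> t) * (of_real (deriv S t) + \<i>)) (at t)"
      by (simp add: o_def mult.commute)
  qed
  then show ?thesis
    by (simp add: screen_integrand_def[abs_def] \<gamma>_def)
qed

text \<open>In the following, \<open>P\<close> is the set of singularities of \<open>f\<close>, and the contour consists of the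
  vertical line \<open>Re s = c\<close>, two horizontal segments and the portion of the screen between them.
  A height is free of poles if no singularity lies on it between the screen and the line, and the
  window points between two heights are the singularities that the contour encloses.\<close>

context
  fixes S :: "real \<Rightarrow> real" and K c :: real and U P :: "complex set" and f :: "complex \<Rightarrow> complex"
  assumes lip: "K-lipschitz_on UNIV S" and Sc: "\<And>t. S t < c"
    and U: "open U" and P: "P sparse_in U" and holo: "f holomorphic_on U - P"
    and window_U: "window S \<subseteq> U" and S_P: "\<And>t. Complex (S t) t \<notin> P" and c_P: "\<And>t. Complex c t \<notin> P"
begin

abbreviation (input) "pole_free_height t \<equiv> (\<forall>x. S t \<le> x \<longrightarrow> x \<le> c \<longrightarrow> Complex x t \<notin> P)"

abbreviation (input) "window_points a b \<equiv> {p \<in> P. S (Im p) \<le> Re p \<and> Re p \<le> c \<and> a < Im p \<and> Im p < b}"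

abbreviation (input) "ray_integral t \<equiv> contour_integral (linepath (Complex (S t) t) (Complex c t)) f"

text \<open>If the heights \<open>a\<close> and \<open>b\<close> are so close that the screen between them stays in a disc free of
  singularities, then the region right of the screen differs from a rectangle only inside that disc,
  where \<open>f\<close> has a primitive. So the residue theorem for the rectangle gives the one for the region.\<close>

lemma thin_strip_residues:
  assumes ab: "a < b" and r: "r > 0" and \<delta>: "(K + 1) * (b - a) \<le> r / 2"
    and ball: "ball (Complex (S a) a) r \<subseteq> U - P"
    and pole_free_height: "pole_free_height a" "pole_free_height b"
  shows "finite (window_points a b)" and "screen_integrand S f integrable_on {a..b}"
    and "ray_integral a + contour_integral (linepath (Complex c a) (Complex c b)) f - ray_integral b
        - integral {a..b} (screen_integrand S f) = 2 * of_real pi * \<i> * (\<Sum>p\<in>window_points a b. residue f p)"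
proof -
  have K: "K \<ge> 0" using lipschitz_on_nonneg[OF lip] .
  define z0 where "z0 = Complex (S a) a"
  have near: "\<bar>S t - S a\<bar> \<le> K * (b - a)" if "t \<in> {a..b}" for t
  proof -
    have "\<bar>S t - S a\<bar> \<le> K * \<bar>t - a\<bar>" using lipschitz_onD[OF lip, of t a] by (simp add: dist_real_def)
    also have "\<dots> \<le> K * (b - a)" using that K by (intro mult_left_mono) auto
    finally show ?thesis .
  qed
  have inB: "Complex x t \<in> cball z0 (r / 2)" if "t \<in> {a..b}" "\<bar>x - S a\<bar> \<le> K * (b - a)" for x t
  proof -
    have "norm (Complex x t - z0) \<le> \<bar>x - S a\<bar> + \<bar>t - a\<bar>"
      using cmod_le[of "Complex x t - z0"] by (simp add: z0_def)
    also have "\<dots> \<le> K * (b - a) + (b - a)" using that by (intro add_mono) auto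
    also have "\<dots> \<le> r / 2" using \<delta> by (simp add: algebra_simps)
    finally show ?thesis by (simp add: dist_norm norm_minus_commute)
  qed
  have cb: "cball z0 (r/2) \<subseteq> ball z0 r" using r by auto
  have fB: "f holomorphic_on ball z0 r"
    using holo ball unfolding z0_def by (rule holomorphic_on_subset)
  obtain F where F': "\<And>z. z \<in> ball z0 r \<Longrightarrow> (F has_field_derivative f z) (at z within ball z0 r)"
    using holomorphic_convex_primitive'[OF convex_ball open_ball fB] by blast
  have F: "(F has_field_derivative f z) (at z)" if "z \<in> ball z0 r" for z
    using F'[OF that] that at_within_open[OF that open_ball] by simp
  have prim: "contour_integral (linepath u v) f = F v - F u" if "u \<in> ball z0 r" "v \<in> ball z0 r" for u v
  proof -
    have "closed_segment u v \<subseteq> ball z0 r" using that by (simp add: closed_segment_subset)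
    then have "(f has_contour_integral (F (pathfinish (linepath u v)) - F (pathstart (linepath u v)))) (linepath u v)"
      by (intro contour_integral_primitive[OF F']) auto
    then show ?thesis by (simp add: contour_integral_unique)
  qed
  have \<gamma>: "Complex (S t) t \<in> cball z0 (r/2)" if "t \<in> {a..b}" for t
    using inB near that by blast
  have screen: "(screen_integrand S f has_integral F (Complex (S b) b) - F (Complex (S a) a)) {a..b}"
    by (rule screen_integrand_primitive[OF lip _ F \<gamma>]) (use ab r in auto)
  then show "screen_integrand S f integrable_on {a..b}" by (rule has_integral_integrable)
  \<comment> \<open>With this left edge both ends of the screen lie on the horizontal sides of the rectangle.\<close>
  define x0 where "x0 = min (S a) (S b)"
  have x0: "\<bar>x0 - S a\<bar> \<le> K * (b - a)" "x0 \<le> S a" "x0 \<le> S b" "x0 < c"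
    using near[of a] near[of b] ab Sc[of a] by (auto simp: x0_def)
  have left: "Complex x t \<in> U - P" if "t \<in> {a..b}" "x0 \<le> x" "x \<le> S t" for x t
  proof -
    have "\<bar>x - S a\<bar> \<le> K * (b - a)" using near[OF that(1)] x0 that by linarith
    then have "Complex x t \<in> ball z0 r" using inB[OF that(1)] cb by blast
    then show ?thesis using ball unfolding z0_def by (rule rev_subsetD)
  qed
  define Q where "Q = cbox (Complex x0 a) (Complex c b)"
  have QU: "Q \<subseteq> U"
  proof
    fix p assume p: "p \<in> Q"
    then have "Im p \<in> {a..b}" "x0 \<le> Re p" by (simp_all add: Q_def in_cbox_complex_iff)
    show "p \<in> U"
    proof (cases "Re p \<le> S (Im p)")
      case True
      then show ?thesis using left[OF \<open>Im p \<in> {a..b}\<close> \<open>x0 \<le> Re p\<close>] by simp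
    next
      case False
      then have "p \<in> window S" by (simp add: window_def)
      then show ?thesis using window_U by blast
    qed
  qed
  have notP: "p \<notin> P" if pQ: "p \<in> Q" and edge: "Re p = x0 \<or> Re p = c \<or> Im p = a \<or> Im p = b" for p
  proof -
    have p: "Im p \<in> {a..b}" "x0 \<le> Re p" "Re p \<le> c" using pQ by (auto simp: Q_def in_cbox_complex_iff)
    show ?thesis
    proof (cases "Re p \<le> S (Im p)")
      case True
      then show ?thesis using left[of "Im p" "Re p"] p by simp
    next
      case False
      consider "Re p = x0" | "Re p = c" | "Im p = a" | "Im p = b" using edge by blast
      then show ?thesis
      proof cases
        case 1
        then have "Complex (Re p) (Im p) \<in> cball z0 (r/2)" using inB p x0 by simp
        then show ?thesis using cb ball by (auto simp: z0_def)
      next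
        case 2
        then show ?thesis using c_P[of "Im p"] by (metis complex.collapse)
      qed (use pole_free_height p False in \<open>metis complex.collapse less_imp_le not_le\<close>)+
    qed
  qed
  have bd: "P \<inter> (cbox (Complex x0 a) (Complex c b) - box (Complex x0 a) (Complex c b)) = {}"
  proof -
    have "Re p = x0 \<or> Re p = c \<or> Im p = a \<or> Im p = b" if "p \<in> Q" "p \<notin> box (Complex x0 a) (Complex c b)" for p
      using that by (auto simp: Q_def in_cbox_complex_iff in_box_complex_iff)
    then show ?thesis using notP unfolding Q_def by blast
  qed
  have R: "P \<inter> box (Complex x0 a) (Complex c b) = window_points a b"
  proof (intro equalityI subsetI)
    fix p assume p: "p \<in> P \<inter> box (Complex x0 a) (Complex c b)"
    then show "p \<in> window_points a b"
      using left[of "Im p" "Re p"] by (cases "S (Im p) \<le> Re p") (auto simp: in_box_complex_iff)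
  next
    fix p assume p: "p \<in> window_points a b"
    have "x0 < Re p"
    proof (rule ccontr)
      assume "\<not> x0 < Re p"
      then have r: "Re p \<le> x0" by simp
      have "Complex (Re p) (Im p) \<in> cball z0 (r/2)"
        using p r near[of "Im p"] x0 by (intro inB) auto
      then show False using cb ball p by (auto simp: z0_def)
    qed
    moreover have "Re p \<noteq> c" using c_P[of "Im p"] p by (metis (no_types, lifting) complex.collapse mem_Collect_eq)
    ultimately show "p \<in> P \<inter> box (Complex x0 a) (Complex c b)"
      using p by (auto simp: in_box_complex_iff)
  qed
  note rect = rectangle_residues[OF U P holo x0(4) ab QU[unfolded Q_def] bd, unfolded R]
  show "finite (window_points a b)" by (rule rect(1))
  have split: "contour_integral (linepath (Complex x0 t) (Complex c t)) f
      = F (Complex (S t) t) - F (Complex x0 t) + ray_integral t" if t: "t = a \<or> t = b" for t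
  proof -
    have tab: "t \<in> {a..b}" using t ab by auto
    have sub: "closed_segment (Complex x0 t) (Complex c t) \<subseteq> U - P"
    proof
      fix p assume "p \<in> closed_segment (Complex x0 t) (Complex c t)"
      then have "Im p = t" "x0 \<le> Re p" "Re p \<le> c"
        using x0 closed_segment_same_Im[of "Complex x0 t" "Complex c t"] by (auto simp: closed_segment_eq_real_ivl)
      then have "p \<in> Q" using ab t by (auto simp: Q_def in_cbox_complex_iff)
      then show "p \<in> U - P" using QU notP \<open>Im p = t\<close> t by blast
    qed
    have "contour_integral (linepath (Complex x0 t) (Complex c t)) f
        = contour_integral (linepath (Complex x0 t) (Complex (S t) t)) f + ray_integral t"
    proof (rule contour_integral_split_linepath)
      show "continuous_on (closed_segment (Complex x0 t) (Complex c t)) f"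
        using holo sub by (meson continuous_on_subset holomorphic_on_imp_continuous_on)
      show "Complex (S t) t \<in> closed_segment (Complex x0 t) (Complex c t)"
        using x0 Sc[of t] t by (subst closed_segment_same_Im) (auto simp: closed_segment_eq_real_ivl)
    qed
    also have "contour_integral (linepath (Complex x0 t) (Complex (S t) t)) f = F (Complex (S t) t) - F (Complex x0 t)"
      using inB[OF tab, of x0] x0 \<gamma>[OF tab] cb by (intro prim) auto
    finally show ?thesis .
  qed
  have vert: "contour_integral (linepath (Complex x0 a) (Complex x0 b)) f = F (Complex x0 b) - F (Complex x0 a)"
    using inB[of a x0] inB[of b x0] x0 ab cb by (intro prim) auto
  show "ray_integral a + contour_integral (linepath (Complex c a) (Complex c b)) f - ray_integral b
        - integral {a..b} (screen_integrand S f) = 2 * of_real pi * \<i> * (\<Sum>p\<in>window_points a b. residue f p)"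
    unfolding rect(2)[symmetric] integral_unique[OF screen] vert
    using split[of a] split[of b] by simp
qed

text \<open>An arbitrary strip is cut into thin ones at heights free of poles. Such heights are plentiful,
  as only finitely many singularities lie in the compact part of the window that is concerned.\<close>

lemma strip_residues:
  assumes ab: "a < b" and pole_free_height: "pole_free_height a" "pole_free_height b"
  shows "finite (window_points a b) \<and> screen_integrand S f integrable_on {a..b} \<and>
     ray_integral a + contour_integral (linepath (Complex c a) (Complex c b)) f - ray_integral b
        - integral {a..b} (screen_integrand S f) = 2 * of_real pi * \<i> * (\<Sum>p\<in>window_points a b. residue f p)"
proof -
  define A B where "A = a" and "B = b"
  have K: "K \<ge> 0" using lipschitz_on_nonneg[OF lip] .
  have contS: "continuous_on X S" for X
    using lip lipschitz_on_continuous_on lipschitz_on_subset by blast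
  have cont\<gamma>: "continuous_on X (\<lambda>t. Complex (S t) t)" for X
    unfolding complex_eq_iff Complex_eq by (intro continuous_intros contS)
  have opn: "open (U - P)" using U P by (rule open_diff_sparse_pts)
  define \<Gamma> where "\<Gamma> = (\<lambda>t. Complex (S t) t) ` {A..B}"
  have cpt: "compact \<Gamma>"
    unfolding \<Gamma>_def by (intro compact_continuous_image cont\<gamma>) simp
  have sub: "\<Gamma> \<subseteq> U - P"
    using window_U S_P by (auto simp: window_def \<Gamma>_def)
  obtain r where r: "r > 0" and balls': "(\<Union>z\<in>\<Gamma>. ball z r) \<subseteq> U - P"
    using compact_subset_open_imp_ball_epsilon_subset[OF cpt opn sub] by blast
  have balls: "ball (Complex (S t) t) r \<subseteq> U - P" if "t \<in> {A..B}" for t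
    using balls' that unfolding UN_subset_iff \<Gamma>_def by blast
  define \<delta> where "\<delta> = r / (2 * (K + 1))"
  have \<delta>: "\<delta> > 0" using r K by (simp add: \<delta>_def)
  define W where "W = {z. S (Im z) \<le> Re z \<and> Re z \<le> c \<and> A \<le> Im z \<and> Im z \<le> B}"
  have "compact W"
  proof (rule compact_Int_closed[of "cbox (Complex (Inf (S ` {A..B})) A) (Complex c B)" "window S", THEN back_subst[of compact]])
    have "continuous_on UNIV (\<lambda>z. S (Im z))"
      using contS[of UNIV] by (intro continuous_on_compose2[OF contS[of UNIV]] continuous_intros) auto
    then show "closed (window S)" unfolding window_def
      by (intro closed_Collect_le continuous_intros)
    have bdd: "bdd_below (S ` {A..B})"
      by (intro bounded_imp_bdd_below compact_imp_bounded compact_continuous_image contS) simp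
    have "Inf (S ` {A..B}) \<le> S t" if "t \<in> {A..B}" for t using bdd that by (auto intro: cInf_lower)
    then have "Inf (S ` {A..B}) \<le> Re z" if "z \<in> W" for z
      using that unfolding W_def by fastforce
    then show "cbox (Complex (Inf (S ` {A..B})) A) (Complex c B) \<inter> window S = W"
      by (auto simp: W_def window_def in_cbox_complex_iff)
  qed auto
  moreover have "W \<subseteq> U" using window_U by (auto simp: W_def window_def)
  ultimately have "finite (W \<inter> P)"
    using sparse_in_compact_finite sparse_in_subset[OF P] by blast
  then have fin: "finite (Im ` (W \<inter> P))" by simp
  have pole_free_heightI: "pole_free_height t" if "t \<in> {A..B}" "t \<notin> Im ` (W \<inter> P)" for t
  proof (intro allI impI notI)
    fix x assume "S t \<le> x" "x \<le> c" "Complex x t \<in> P"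
    then have "Complex x t \<in> W \<inter> P" using that(1) by (simp add: W_def)
    then have "Im (Complex x t) \<in> Im ` (W \<inter> P)" by (rule imageI)
    then show False using that(2) by simp
  qed
  define E where "E a b \<longleftrightarrow> finite (window_points a b) \<and> screen_integrand S f integrable_on {a..b} \<and>
     ray_integral a + contour_integral (linepath (Complex c a) (Complex c b)) f - ray_integral b
        - integral {a..b} (screen_integrand S f) = 2 * of_real pi * \<i> * (\<Sum>p\<in>window_points a b. residue f p)" for a b
  have E_small: "E a b" if "A \<le> a" "a < b" "b \<le> B" "b - a \<le> \<delta>" "pole_free_height a" "pole_free_height b" for a b
  proof -
    have "(K + 1) * (b - a) \<le> (K + 1) * \<delta>" using that K by (intro mult_left_mono) auto
    also have "\<dots> = r / 2" using K by (simp add: \<delta>_def field_simps)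
    finally show ?thesis
      unfolding E_def using that(1-3) by (intro conjI thin_strip_residues[OF that(2) r _ balls that(5,6)]) auto
  qed
  have E_trans: "E a b" if "E a m" "E m b" "a < m" "m < b" "pole_free_height m" for a m b
  proof -
    have dj: "window_points a b = window_points a m \<union> window_points m b" "window_points a m \<inter> window_points m b = {}"
    proof -
      have "Im p \<noteq> m" if "p \<in> P" "S (Im p) \<le> Re p" "Re p \<le> c" for p
        using that \<open>pole_free_height m\<close> by (metis complex.collapse)
      then show "window_points a b = window_points a m \<union> window_points m b" using \<open>a < m\<close> \<open>m < b\<close> by force
      show "window_points a m \<inter> window_points m b = {}" by force
    qed
    have vc: "continuous_on (closed_segment (Complex c a) (Complex c b)) f"
    proof (rule continuous_on_subset[OF holomorphic_on_imp_continuous_on[OF holo]])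
      show "closed_segment (Complex c a) (Complex c b) \<subseteq> U - P"
      proof
        fix p assume "p \<in> closed_segment (Complex c a) (Complex c b)"
        then have "p = Complex c (Im p)"
          using closed_segment_same_Re[of "Complex c a" "Complex c b"] by (auto simp: complex_eq_iff)
        then show "p \<in> U - P" using c_P[of "Im p"] window_U Sc[of "Im p"]
          by (metis DiffI complex.sel less_imp_le mem_Collect_eq subsetD window_def)
      qed
    qed
    define V where "V u v = contour_integral (linepath (Complex c u) (Complex c v)) f" for u v
    define J where "J u v = integral {u..v} (screen_integrand S f)" for u v
    define R where "R u v = (\<Sum>p\<in>window_points u v. residue f p)" for u v
    have V: "V a b = V a m + V m b"
      unfolding V_def using vc \<open>a < m\<close> \<open>m < b\<close> by (intro contour_integral_split_linepath)
         (auto simp: closed_segment_same_Re closed_segment_eq_real_ivl)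
    have E1: "finite (window_points a m)" "screen_integrand S f integrable_on {a..m}"
        "ray_integral a + V a m - ray_integral m - J a m = 2 * of_real pi * \<i> * R a m"
      using \<open>E a m\<close> unfolding E_def V_def J_def R_def by blast+
    have E2: "finite (window_points m b)" "screen_integrand S f integrable_on {m..b}"
        "ray_integral m + V m b - ray_integral b - J m b = 2 * of_real pi * \<i> * R m b"
      using \<open>E m b\<close> unfolding E_def V_def J_def R_def by blast+
    have int: "screen_integrand S f integrable_on {a..b}"
      by (rule Henstock_Kurzweil_Integration.integrable_combine[OF _ _ E1(2) E2(2)])
         (use \<open>a < m\<close> \<open>m < b\<close> in simp_all)
    have J: "J a b = J a m + J m b"
      unfolding J_def
      by (rule Henstock_Kurzweil_Integration.integral_combine[OF _ _ int, symmetric])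
         (use \<open>a < m\<close> \<open>m < b\<close> in simp_all)
    have R: "R a b = R a m + R m b"
      unfolding R_def dj(1) by (rule sum.union_disjoint[OF E1(1) E2(1) dj(2)])
    have regroup: "h0 + (v1 + v2) - h2 - (j1 + j2) = (h0 + v1 - h1 - j1) + (h1 + v2 - h2 - j2)"
      for h0 h1 h2 v1 v2 j1 j2 :: complex by simp
    have "ray_integral a + V a b - ray_integral b - J a b = (ray_integral a + V a m - ray_integral m - J a m) + (ray_integral m + V m b - ray_integral b - J m b)"
      unfolding V J by (rule regroup)
    also have "\<dots> = 2 * of_real pi * \<i> * R a b"
      unfolding E1(3) E2(3) R by (rule distrib_left[symmetric])
    finally have "ray_integral a + V a b - ray_integral b - J a b = 2 * of_real pi * \<i> * R a b" .
    moreover have "finite (window_points a b)" unfolding dj(1) using E1(1) E2(1) by (rule finite_UnI)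
    ultimately show ?thesis using int unfolding E_def V_def J_def R_def by blast
  qed
  have E_all: "E a b" if "A \<le> a" "a < b" "b \<le> B" "b - a \<le> real (Suc n) * (\<delta> / 2)" "pole_free_height a" "pole_free_height b" for n a b
    using that
  proof (induction n arbitrary: b)
    case 0
    have "b - a \<le> \<delta>" using 0(4) \<delta> by simp
    then show ?case using 0 by (intro E_small)
  next
    case (Suc n)
    show ?case
    proof (cases "b - a \<le> \<delta>")
      case True
      then show ?thesis using Suc.prems by (intro E_small)
    next
      case False
      have "infinite {b - \<delta><..<b - \<delta> / 2}" using \<delta> by (intro infinite_Ioo) auto
      then obtain m where m: "m \<in> {b - \<delta><..<b - \<delta> / 2}" "m \<notin> Im ` (W \<inter> P)"
        using fin by (meson finite_subset subsetI)
      have mm: "b - \<delta> < m" "m < b - \<delta> / 2" using m(1) by auto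
      have am: "a < m" and mb: "m < b" using mm False \<delta> by linarith+
      have AB: "A \<le> m" "m \<le> B" using am mb Suc.prems(1,3) by linarith+
      then have gm: "pole_free_height m" using m(2) by (intro pole_free_heightI) auto
      have "m - a \<le> b - a - \<delta> / 2" using mm by linarith
      also have "\<dots> \<le> real (Suc n) * (\<delta> / 2)" using Suc.prems(4) by (simp add: algebra_simps)
      finally have "E a m" using Suc.IH[OF Suc.prems(1) am AB(2) _ Suc.prems(5) gm] by blast
      moreover have "E m b" using mm by (intro E_small[OF AB(1) mb Suc.prems(3) _ gm Suc.prems(6)]) simp
      ultimately show ?thesis using am mb gm by (rule E_trans)
    qed
  qed
  obtain n where "(b - a) / (\<delta> / 2) < real n" using reals_Archimedean2 by blast
  then have "b - a \<le> real (Suc n) * (\<delta> / 2)" using \<delta> by (simp add: field_simps)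
  then have "E a b" by (intro E_all[OF _ ab _ _ pole_free_height]) (auto simp: A_def B_def)
  then show ?thesis unfolding E_def .
qed

end

section \<open>A Perron integral\<close>

text \<open>The standard majorant for integrands on the whole line: constant near the origin and
  \<open>\<bar>t\<bar> powr (- p)\<close> further out. It is integrable for \<open>p > 1\<close>.\<close>

definition decay :: "real \<Rightarrow> real \<Rightarrow> real" where
  "decay p t = (if \<bar>t\<bar> \<le> 1 then 1 else \<bar>t\<bar> powr (- p))"

lemma decay_nonneg: "decay p t \<ge> 0"
  by (simp add: decay_def)

lemma integrable_decay:
  assumes "p > 1" shows "integrable lebesgue (decay p)"
proof -
  define w where "w t = indicator {1..} t *\<^sub>R (t powr (- p))" for t :: real
  have "(\<lambda>t. t powr (- p)) integrable_on {1::real..}"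
    using has_integral_powr_to_inf[of "- p" 1] assms by (auto intro: has_integral_integrable)
  then have "(\<lambda>t. t powr (- p)) absolutely_integrable_on {1::real..}"
    by (intro nonnegative_absolutely_integrable_1) auto
  then have "integrable (completion lborel) w"
    by (simp add: set_integrable_def w_def[abs_def])
  moreover have w_meas [measurable]: "w \<in> borel_measurable borel" unfolding w_def by measurable
  ultimately have w: "integrable lborel w" by (subst (asm) integrable_completion) auto
  have w': "integrable lborel (\<lambda>t. w (- t))" using lborel_integrable_real_affine[OF w, of "-1" 0] by simp
  have i: "integrable lborel (indicator {-1..1::real} :: real \<Rightarrow> real)" by simp
  have "integrable lborel (\<lambda>t. indicator {-1..1} t + w t + w (- t))"
    using w w' i by (intro Bochner_Integration.integrable_add)
  then have "integrable lborel (decay p)"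
  proof (rule Bochner_Integration.integrable_bound)
    show "decay p \<in> borel_measurable lborel" unfolding decay_def by measurable
    show "AE t in lborel. norm (decay p t) \<le> norm (indicator {-1..1} t + w t + w (- t))"
      by (intro AE_I2) (auto simp: decay_def w_def indicator_def)
  qed
  then show ?thesis using integrable_completion[of "decay p" lborel]
    by (auto simp: borel_measurable_integrable)
qed

lemma integrable_decay_bound:
  fixes h :: "real \<Rightarrow> complex"
  assumes "h \<in> borel_measurable lebesgue" "p > 1" and "AE t in lebesgue. norm (h t) \<le> C * decay p t"
  shows "integrable lebesgue h"
proof (rule Bochner_Integration.integrable_bound)
  show "integrable lebesgue (\<lambda>t. C * decay p t)"
    using integrable_decay[OF \<open>p > 1\<close>] by simp
  show "AE t in lebesgue. norm (h t) \<le> norm (C * decay p t)"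
    using assms(3) by eventually_elim auto
qed fact

lemma continuous_imp_lebesgue_measurable:
  fixes h :: "real \<Rightarrow> complex"
  assumes "continuous_on UNIV h" shows "h \<in> borel_measurable lebesgue"
  using assms by (intro measurable_completion) (simp add: borel_measurable_continuous_onI)

lemma decay_bound_continuous:
  fixes h :: "real \<Rightarrow> complex"
  assumes cont: "continuous_on UNIV h" and C: "\<And>t. \<bar>t\<bar> \<ge> 1 \<Longrightarrow> norm (h t) \<le> C * \<bar>t\<bar> powr (- p)"
  obtains C' where "C' > 0" "\<And>t. norm (h t) \<le> C' * decay p t"
proof -
  have "bounded (h ` {-1..1})"
    by (intro compact_imp_bounded compact_continuous_image continuous_on_subset[OF cont]) auto
  then obtain B where B: "B > 0" "\<forall>z\<in>h ` {-1..1}. norm z \<le> B" unfolding bounded_pos by blast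
  show ?thesis
  proof
    show "max B C > 0" using B by auto
    fix t :: real
    show "norm (h t) \<le> max B C * decay p t"
    proof (cases "\<bar>t\<bar> \<le> 1")
      case True
      then have "h t \<in> h ` {-1..1}" by (intro imageI) auto
      then show ?thesis using B(2) True by (auto simp: decay_def)
    next
      case False
      then have "norm (h t) \<le> C * \<bar>t\<bar> powr (- p)" by (intro C) simp
      also have "\<dots> \<le> max B C * \<bar>t\<bar> powr (- p)" by (intro mult_right_mono) auto
      finally show ?thesis using False by (simp add: decay_def)
    qed
  qed
qed

lemma integral_exhausting_tendsto:
  fixes h :: "real \<Rightarrow> complex"
  assumes h: "integrable lebesgue h" and a: "filterlim a at_bot sequentially" and b: "filterlim b at_top sequentially"
  shows "(\<lambda>n. integral {a n..b n} h) \<longlonglongrightarrow> (LINT t|lebesgue. h t)"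
proof -
  have "(\<lambda>n. LINT t|lebesgue. indicator {a n..b n} t *\<^sub>R h t) \<longlonglongrightarrow> (LINT t|lebesgue. h t)"
  proof (rule integral_dominated_convergence)
    show "integrable lebesgue (\<lambda>t. norm (h t))" using h by simp
    show "AE t in lebesgue. (\<lambda>n. indicator {a n..b n} t *\<^sub>R h t) \<longlonglongrightarrow> h t"
    proof (rule AE_I2)
      fix t
      have "eventually (\<lambda>n. a n \<le> t) sequentially" "eventually (\<lambda>n. t \<le> b n) sequentially"
        using a b by (auto simp: filterlim_at_bot filterlim_at_top)
      then have "eventually (\<lambda>n. indicator {a n..b n} t *\<^sub>R h t = h t) sequentially"
        by eventually_elim auto
      then show "(\<lambda>n. indicator {a n..b n} t *\<^sub>R h t) \<longlonglongrightarrow> h t" by (rule tendsto_eventually)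
    qed
    show "(\<lambda>t. indicator {a n..b n} t *\<^sub>R h t) \<in> borel_measurable lebesgue" for n
      using h by (intro borel_measurable_integrable integrable_mult_indicator) auto
  qed (use h in \<open>auto simp: indicator_def\<close>)
  moreover have "(LINT t|lebesgue. indicator {a n..b n} t *\<^sub>R h t) = integral {a n..b n} h" for n
  proof -
    have "set_integrable lebesgue {a n..b n} h"
      unfolding set_integrable_def using h by (intro integrable_mult_indicator) auto
    then show ?thesis using set_lebesgue_integral_eq_integral(2) by (fastforce simp: set_lebesgue_integral_def)
  qed
  ultimately show ?thesis by simp
qed

text \<open>A Perron integral with two simple poles to the left of the line of integration. For \<open>y \<ge> 1\<close> the
  contour is closed to the left and picks up both residues, for \<open>y < 1\<close> it is closed to the right and
  encloses no pole.\<close>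

lemma perron_kernel:
  fixes p q c y :: real
  defines "h \<equiv> \<lambda>t. of_real y powr Complex c t / ((Complex c t - of_real p) * (Complex c t - of_real q))"
  assumes pq: "p < q" "q < c" and y: "y > 0"
  shows "integrable lebesgue h"
    and "(LINT t|lebesgue. h t) = (if y \<ge> 1 then 2 * of_real pi * of_real ((y powr q - y powr p) / (q - p)) else 0)"
proof -
  define u where "u = ln y"
  define F where "F s = exp (s * of_real u) / ((s - of_real p) * (s - of_real q))" for s :: complex
  have hF: "h t = F (Complex c t)" for t
    using y by (simp add: h_def F_def powr_def u_def Ln_of_real)
  have nexp: "norm (exp (s * of_real u)) = exp (Re s * u)" for s :: complex by simp
  have nz: "Complex c t - of_real p \<noteq> 0" "Complex c t - of_real q \<noteq> 0" for t
    using pq by (auto simp: complex_eq_iff)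
  have conth: "continuous_on UNIV h"
    unfolding hF F_def Complex_eq using nz[unfolded Complex_eq] by (intro continuous_intros) auto
  have hb: "norm (h t) \<le> exp (c * u) * \<bar>t\<bar> powr (- 2)" if "\<bar>t\<bar> \<ge> 1" for t
  proof -
    have t: "\<bar>t\<bar> \<le> norm (Complex c t - of_real p)" "\<bar>t\<bar> \<le> norm (Complex c t - of_real q)"
      using abs_Im_le_cmod[of "Complex c t - of_real p"] abs_Im_le_cmod[of "Complex c t - of_real q"] by simp_all
    have pos: "0 < \<bar>t\<bar> * \<bar>t\<bar>" using that by (intro mult_pos_pos) auto
    have "\<bar>t\<bar> * \<bar>t\<bar> \<le> norm (Complex c t - of_real p) * norm (Complex c t - of_real q)"
      using t by (intro mult_mono) auto
    from frac_le[OF _ order_refl pos this] have "norm (h t) \<le> exp (c * u) / (\<bar>t\<bar> * \<bar>t\<bar>)"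
      unfolding hF F_def norm_divide norm_mult nexp complex.sel by simp
    also have "\<dots> = exp (c * u) * \<bar>t\<bar> powr (- 2)"
    proof -
      have "t \<noteq> 0" using that by auto
      then have "\<bar>t\<bar> powr 2 = \<bar>t\<bar> * \<bar>t\<bar>" by (simp add: powr_numeral power2_eq_square)
      then show ?thesis by (simp only: powr_minus divide_inverse)
    qed
    finally show ?thesis .
  qed
  obtain C where C: "C > 0" "\<And>t. norm (h t) \<le> C * decay 2 t"
    using decay_bound_continuous[OF conth hb] by blast
  show int: "integrable lebesgue h"
    by (rule integrable_decay_bound[OF continuous_imp_lebesgue_measurable[OF conth], of 2 C]) (use C in auto)
  define V where "V R = contour_integral (linepath (Complex c (- R)) (Complex c R)) F" for R
  have V_eq: "V R = \<i> * integral {- R..R} h" if "R > 0" for R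
    unfolding V_def hF using that by (intro contour_integral_linepath_same_Re) auto
  have V_lim: "(\<lambda>n. V (real n)) \<longlonglongrightarrow> \<i> * (LINT t|lebesgue. h t)"
  proof (rule Lim_transform_eventually)
    show "(\<lambda>n. \<i> * integral {- real n..real n} h) \<longlonglongrightarrow> \<i> * (LINT t|lebesgue. h t)"
      using int
      by (intro tendsto_mult tendsto_const integral_exhausting_tendsto filterlim_real_sequentially
            filterlim_compose[OF filterlim_uminus_at_bot_at_top filterlim_real_sequentially])
    show "\<forall>\<^sub>F n in sequentially. \<i> * integral {- real n..real n} h = V (real n)"
      using eventually_gt_at_top[of 0] by eventually_elim (simp add: V_eq)
  qed
  define P where "P = {complex_of_real p, complex_of_real q}"
  have P: "P sparse_in UNIV" "F holomorphic_on UNIV - P"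
    by (auto simp: P_def F_def[abs_def] finite_imp_sparse intro!: holomorphic_intros)
  define R0 where "R0 = 2 * (\<bar>p\<bar> + \<bar>q\<bar> + \<bar>c\<bar> + 1)"
  \<comment> \<open>This bound serves for the three sides of the rectangular contour other than \<open>Re s = c\<close>.\<close>
  have side: "norm (contour_integral (linepath z w) F) \<le> 8 * exp (c * u) / R"
    if R: "R \<ge> R0" and "norm (w - z) \<le> 2 * R"
      and seg: "\<And>s. s \<in> closed_segment z w \<Longrightarrow> (\<bar>Re s\<bar> = R \<or> \<bar>Im s\<bar> = R) \<and> Re s * u \<le> c * u" for z w R
  proof -
    have Rpos: "R > 0" "R \<ge> 2 * \<bar>p\<bar>" "R \<ge> 2 * \<bar>q\<bar>" using R by (auto simp: R0_def)
    have far: "R / 2 \<le> norm (s - of_real x)" if "s \<in> closed_segment z w" "R \<ge> 2 * \<bar>x\<bar>" for s x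
    proof -
      have "R / 2 \<le> \<bar>Re s - x\<bar> \<or> R / 2 \<le> \<bar>Im s\<bar>" using seg[OF that(1)] that(2) Rpos(1) by linarith
      then show ?thesis using abs_Re_le_cmod[of "s - of_real x"] abs_Im_le_cmod[of "s - of_real x"] by auto
    qed
    have FB: "norm (F s) \<le> 4 * exp (c * u) / R\<^sup>2" if s: "s \<in> closed_segment z w" for s
    proof -
      have pos: "0 < (R / 2) * (R / 2)" using Rpos by simp
      have "(R / 2) * (R / 2) \<le> norm (s - of_real p) * norm (s - of_real q)"
        using far[OF s] Rpos by (intro mult_mono) auto
      from frac_le[OF _ order_refl pos this] have "norm (F s) \<le> exp (Re s * u) / ((R / 2) * (R / 2))"
        unfolding F_def norm_divide norm_mult nexp by simp
      also have "\<dots> \<le> exp (c * u) / ((R / 2) * (R / 2))"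
        using seg[OF s] by (intro divide_right_mono) auto
      also have "\<dots> = 4 * exp (c * u) / R\<^sup>2" using Rpos by (simp add: power2_eq_square field_simps)
      finally show ?thesis .
    qed
    have "closed_segment z w \<subseteq> UNIV - P"
      using far[of _ p] far[of _ q] Rpos by (force simp: P_def)
    then have "F contour_integrable_on linepath z w"
      using P(2) by (meson contour_integrable_continuous_linepath continuous_on_subset holomorphic_on_imp_continuous_on)
    then have "norm (contour_integral (linepath z w) F) \<le> 4 * exp (c * u) / R\<^sup>2 * norm (w - z)"
      using FB Rpos by (intro contour_integral_bound_linepath) auto
    also have "\<dots> \<le> 4 * exp (c * u) / R\<^sup>2 * (2 * R)"
      using \<open>norm (w - z) \<le> 2 * R\<close> by (intro mult_left_mono) auto
    also have "\<dots> = 8 * exp (c * u) / R" using Rpos by (simp add: power2_eq_square)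
    finally show ?thesis .
  qed
  have lim0: "(\<lambda>n. 24 * exp (c * u) / real n) \<longlonglongrightarrow> 0" by real_asymp
  have concl: "(LINT t|lebesgue. h t) = 2 * of_real pi * L"
    if bound: "\<And>R. R \<ge> R0 \<Longrightarrow> norm (V R - 2 * of_real pi * \<i> * L) \<le> 24 * exp (c * u) / R" for L
  proof -
    have "(\<lambda>n. V (real n) - 2 * of_real pi * \<i> * L) \<longlonglongrightarrow> 0"
    proof (rule Lim_null_comparison[OF _ lim0])
      have "eventually (\<lambda>n. real n \<ge> R0) sequentially"
        using filterlim_real_sequentially unfolding filterlim_at_top by blast
      then show "\<forall>\<^sub>F n in sequentially. norm (V (real n) - 2 * of_real pi * \<i> * L) \<le> 24 * exp (c * u) / real n"
        by eventually_elim (rule bound)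
    qed
    then have "(\<lambda>n. V (real n)) \<longlonglongrightarrow> 2 * of_real pi * \<i> * L" by (simp add: LIM_zero_iff)
    then have "\<i> * (LINT t|lebesgue. h t) = \<i> * (2 * of_real pi * L)"
      using LIMSEQ_unique[OF V_lim] by (simp add: mult_ac)
    then show ?thesis by simp
  qed
  have segRe: "Im s = m \<and> min a b \<le> Re s \<and> Re s \<le> max a b" if "s \<in> closed_segment (Complex a m) (Complex b m)" for s a b m
    using that by (subst (asm) closed_segment_same_Im) (auto simp: closed_segment_eq_real_ivl split: if_splits)
  have segIm: "Re s = m \<and> min a b \<le> Im s \<and> Im s \<le> max a b" if "s \<in> closed_segment (Complex m a) (Complex m b)" for s a b m
    using that by (subst (asm) closed_segment_same_Re) (auto simp: closed_segment_eq_real_ivl split: if_splits)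
  have nRe: "norm (Complex b m - Complex a m) = \<bar>b - a\<bar>" for a b m
    using cmod_eq_Re by simp
  have nIm: "norm (Complex m b - Complex m a) = \<bar>b - a\<bar>" for a b m
    using cmod_eq_Im by simp
  show "(LINT t|lebesgue. h t) = (if y \<ge> 1 then 2 * of_real pi * of_real ((y powr q - y powr p) / (q - p)) else 0)"
  proof (cases "y \<ge> 1")
    case True
    then have u: "u \<ge> 0" by (simp add: u_def)
    have "(LINT t|lebesgue. h t) = 2 * of_real pi * of_real ((y powr q - y powr p) / (q - p))"
    proof (rule concl)
      fix R assume R: "R \<ge> R0"
      then have Rpos: "R > 0" "\<bar>p\<bar> < R" "\<bar>q\<bar> < R" "\<bar>c\<bar> < R" by (auto simp: R0_def)
      have "P \<inter> (cbox (Complex (- R) (- R)) (Complex c R) - box (Complex (- R) (- R)) (Complex c R)) = {}"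
        using Rpos pq by (auto simp: P_def in_box_complex_iff)
      note rr = rectangle_residues(2)[OF open_UNIV P _ _ subset_UNIV this]
      have "P \<inter> box (Complex (- R) (- R)) (Complex c R) = P"
        using Rpos pq by (auto simp: P_def in_box_complex_iff)
      moreover have "residue F (of_real q) = exp (of_real q * of_real u) / (of_real q - of_real p)"
      proof -
        have "residue (\<lambda>s. (exp (s * of_real u) / (s - of_real p)) / (s - of_real q)) (of_real q)
            = exp (of_real q * of_real u) / (of_real q - of_real p)"
          using pq by (intro residue_simple[of "- {of_real p}"]) (auto intro!: holomorphic_intros)
        then show ?thesis by (simp add: F_def[abs_def])
      qed
      moreover have "residue F (of_real p) = exp (of_real p * of_real u) / (of_real p - of_real q)"
      proof -
        have "residue (\<lambda>s. (exp (s * of_real u) / (s - of_real q)) / (s - of_real p)) (of_real p)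
            = exp (of_real p * of_real u) / (of_real p - of_real q)"
          using pq by (intro residue_simple[of "- {of_real q}"]) (auto intro!: holomorphic_intros)
        then show ?thesis by (simp add: F_def[abs_def] mult.commute)
      qed
      ultimately have res: "(\<Sum>s\<in>P \<inter> box (Complex (- R) (- R)) (Complex c R). residue F s)
          = exp (of_real p * of_real u) / (of_real p - of_real q) + exp (of_real q * of_real u) / (of_real q - of_real p)"
        using pq by (simp add: P_def)
      also have "\<dots> = of_real ((y powr q - y powr p) / (q - p))"
      proof -
        have ey: "exp (complex_of_real x * of_real u) = of_real (y powr x)" for x
          using y by (simp add: powr_def u_def mult.commute flip: exp_of_real of_real_mult)
        have "1 / (complex_of_real p - of_real q) = - 1 / (of_real q - of_real p)"
          by (metis minus_diff_eq minus_divide_left minus_divide_right)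
        then show ?thesis unfolding ey
          by (simp add: diff_divide_distrib divide_inverse algebra_simps)
      qed
      finally have res: "(\<Sum>s\<in>P \<inter> box (Complex (- R) (- R)) (Complex c R). residue F s) = of_real ((y powr q - y powr p) / (q - p))" .
      define A B E where "A = contour_integral (linepath (Complex (- R) (- R)) (Complex c (- R))) F"
        and "B = contour_integral (linepath (Complex (- R) R) (Complex c R)) F"
        and "E = contour_integral (linepath (Complex (- R) (- R)) (Complex (- R) R)) F"
      have "A + V R - B - E = 2 * of_real pi * \<i> * of_real ((y powr q - y powr p) / (q - p))"
        using rr Rpos unfolding res A_def B_def E_def V_def by simp
      then have "V R - 2 * of_real pi * \<i> * of_real ((y powr q - y powr p) / (q - p)) = B + E - A"
        by (simp add: algebra_simps)
      also have "norm \<dots> \<le> norm B + norm E + norm A"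
        by (metis add_right_mono norm_triangle_ineq norm_triangle_ineq4 order_trans)
      also have "norm A \<le> 8 * exp (c * u) / R"
        unfolding A_def by (rule side[OF R]) (use Rpos nRe u in \<open>auto dest!: segRe intro!: mult_right_mono\<close>)
      also have "norm B \<le> 8 * exp (c * u) / R"
        unfolding B_def by (rule side[OF R]) (use Rpos nRe u in \<open>auto dest!: segRe intro!: mult_right_mono\<close>)
      also have "norm E \<le> 8 * exp (c * u) / R"
        unfolding E_def by (rule side[OF R]) (use Rpos nIm u in \<open>auto dest!: segIm intro!: mult_right_mono\<close>)
      finally show "norm (V R - 2 * of_real pi * \<i> * of_real ((y powr q - y powr p) / (q - p))) \<le> 24 * exp (c * u) / R"
        by simp
    qed
    then show ?thesis using True by simp
  next
    case False
    then have u: "u \<le> 0" using y by (simp add: u_def)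
    have "(LINT t|lebesgue. h t) = 2 * of_real pi * 0"
    proof (rule concl)
      fix R assume R: "R \<ge> R0"
      then have Rpos: "R > 0" "\<bar>p\<bar> < R" "\<bar>q\<bar> < R" "\<bar>c\<bar> < R" by (auto simp: R0_def)
      have emp: "P \<inter> cbox (Complex c (- R)) (Complex R R) = {}"
        using Rpos pq by (auto simp: P_def in_cbox_complex_iff)
      then have "P \<inter> (cbox (Complex c (- R)) (Complex R R) - box (Complex c (- R)) (Complex R R)) = {}" by blast
      note rr = rectangle_residues(2)[OF open_UNIV P _ _ subset_UNIV this]
      have e2: "P \<inter> box (Complex c (- R)) (Complex R R) = {}" using emp box_subset_cbox by blast
      define A B E where "A = contour_integral (linepath (Complex c (- R)) (Complex R (- R))) F"
        and "B = contour_integral (linepath (Complex c R) (Complex R R)) F"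
        and "E = contour_integral (linepath (Complex R (- R)) (Complex R R)) F"
      have "A + E - B - V R = 0"
        using rr Rpos unfolding e2 A_def B_def E_def V_def by simp
      then have "V R - 2 * of_real pi * \<i> * 0 = A + E - B" by (simp add: algebra_simps)
      also have "norm \<dots> \<le> norm A + norm E + norm B"
        by (metis add_right_mono norm_triangle_ineq norm_triangle_ineq4 order_trans)
      also have "norm A \<le> 8 * exp (c * u) / R"
        unfolding A_def by (rule side[OF R]) (use Rpos nRe u in \<open>auto dest!: segRe intro!: mult_right_mono_neg\<close>)
      also have "norm B \<le> 8 * exp (c * u) / R"
        unfolding B_def by (rule side[OF R]) (use Rpos nRe u in \<open>auto dest!: segRe intro!: mult_right_mono_neg\<close>)
      also have "norm E \<le> 8 * exp (c * u) / R"
        unfolding E_def by (rule side[OF R]) (use Rpos nIm u in \<open>auto dest!: segIm intro!: mult_right_mono_neg\<close>)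
      finally show "norm (V R - 2 * of_real pi * \<i> * 0) \<le> 24 * exp (c * u) / R"
        by simp
    qed
    then show ?thesis using False by simp
  qed
qed

section \<open>Zeta functions of fractal strings\<close>

lemma fractal_string_bounds:
  assumes "fractal_string L" shows "0 < L j" "L j \<le> 1"
  using assms decseqD[of L 0 j] by (auto simp: fractal_string_def)

lemma summable_powr_abscissa:
  assumes L: "fractal_string L" and "abscissa L < ereal \<sigma>"
  shows "summable (\<lambda>j. L j powr \<sigma>)"
proof -
  obtain \<sigma>0 where s: "summable (\<lambda>j. L j powr \<sigma>0)" "\<sigma>0 < \<sigma>"
    using assms(2) unfolding abscissa_def Inf_less_iff by auto
  have "norm (L j powr \<sigma>) \<le> L j powr \<sigma>0" for j
    using fractal_string_bounds[OF L, of j] s(2) by (simp add: powr_mono')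
  then show ?thesis by (intro summable_comparison_test'[OF s(1), of 0]) auto
qed

lemma abscissa_nonneg:
  assumes L: "fractal_string L" shows "0 \<le> abscissa L"
  unfolding abscissa_def le_Inf_iff
proof
  fix x assume "x \<in> ereal ` {\<sigma>. summable (\<lambda>j. L j powr \<sigma>)}"
  then obtain \<sigma> where \<sigma>: "x = ereal \<sigma>" "summable (\<lambda>j. L j powr \<sigma>)" by auto
  have "\<sigma> > 0"
  proof (rule ccontr)
    assume "\<not> \<sigma> > 0"
    then have "1 \<le> L j powr \<sigma>" for j
      using fractal_string_bounds[OF L, of j] powr_mono'[of \<sigma> 0 "L j"] by simp
    then show False using LIMSEQ_le_const[OF summable_LIMSEQ_zero[OF \<sigma>(2)], of 1] by auto
  qed
  then show "0 \<le> x" using \<sigma> by simp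
qed

lemma norm_string_zeta_term:
  assumes "fractal_string L"
  shows "norm (complex_of_real (L j) powr s) = L j powr Re s"
  using fractal_string_bounds[OF assms, of j] by (simp add: norm_powr_real_powr)

lemma string_zeta_series_bound:
  assumes L: "fractal_string L" and \<sigma>: "abscissa L < ereal \<sigma>" and s: "\<sigma> \<le> Re s"
  shows "summable (\<lambda>j. norm (complex_of_real (L j) powr s))"
    and "norm (string_zeta_series L s) \<le> (\<Sum>j. L j powr \<sigma>)"
proof -
  have le: "norm (complex_of_real (L j) powr s) \<le> L j powr \<sigma>" for j
    unfolding norm_string_zeta_term[OF L]
    using fractal_string_bounds[OF L, of j] s by (simp add: powr_mono')
  note S = summable_powr_abscissa[OF L \<sigma>]
  show 1: "summable (\<lambda>j. norm (complex_of_real (L j) powr s))"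
    by (rule summable_comparison_test'[OF S, of 0]) (use le in auto)
  have "norm (string_zeta_series L s) \<le> (\<Sum>j. norm (complex_of_real (L j) powr s))"
    unfolding string_zeta_series_def by (rule summable_norm[OF 1])
  also have "\<dots> \<le> (\<Sum>j. L j powr \<sigma>)" by (rule suminf_le[OF le 1 S])
  finally show "norm (string_zeta_series L s) \<le> (\<Sum>j. L j powr \<sigma>)" .
qed

lemma convergence_halfplane_margin:
  assumes L: "fractal_string L" and s: "s \<in> convergence_halfplane L"
  obtains \<sigma> where "abscissa L < ereal \<sigma>" "\<sigma> < Re s"
  using s ereal_dense2[of "abscissa L" "ereal (Re s)"] unfolding convergence_halfplane_def by auto

lemma open_convergence_halfplane: "open (convergence_halfplane L)"
proof -
  have "convergence_halfplane L = (\<lambda>s. ereal (Re s)) -` {abscissa L<..}"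
    by (auto simp: convergence_halfplane_def)
  moreover have "open \<dots>"
    by (intro open_vimage open_greaterThan continuous_intros)
  ultimately show ?thesis by simp
qed

lemma string_zeta_continues:
  assumes "screen L U S"
  shows "continues_to (string_zeta_series L) (convergence_halfplane L) U (string_zeta L U)"
  using assms unfolding screen_def string_zeta_def meromorphic_continuation_def
  by (intro someI_ex[of "continues_to (string_zeta_series L) (convergence_halfplane L) U"]) blast

text \<open>The series is bounded by its value at a real point to the left, so its continuation, which
  agrees with it there, has no pole in the half-plane of convergence.\<close>

lemma string_zeta_no_pole_halfplane:
  assumes L: "fractal_string L" and scr: "screen L U S" and s: "s \<in> convergence_halfplane L"
  shows "\<not> is_pole (string_zeta L U) s"
proof
  assume pole: "is_pole (string_zeta L U) s"
  obtain \<sigma> where \<sigma>: "abscissa L < ereal \<sigma>" "\<sigma> < Re s"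
    using convergence_halfplane_margin[OF L s] .
  define B where "B = (\<Sum>j. L j powr \<sigma>)"
  have "open {z. \<sigma> < Re z}" by (intro open_Collect_less continuous_intros)
  then have "eventually (\<lambda>z. z \<in> {z. \<sigma> < Re z}) (at s)"
    using \<sigma>(2) by (intro eventually_at_in_open') auto
  then have 1: "eventually (\<lambda>z. norm (string_zeta L U z) \<le> B) (at s)"
  proof eventually_elim
    case (elim z)
    then have z: "\<sigma> < Re z" by simp
    then have "z \<in> convergence_halfplane L"
      using \<sigma>(1) unfolding convergence_halfplane_def by (auto intro: less_trans)
    then have "string_zeta L U z = string_zeta_series L z"
      using string_zeta_continues[OF scr] by (auto simp: continues_to_def)
    then show ?case using string_zeta_series_bound(2)[OF L \<sigma>(1), of z] z by (simp add: B_def)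
  qed
  have "eventually (\<lambda>z. norm (string_zeta L U z) > B) (at s)"
    using pole unfolding is_pole_def filterlim_at_infinity_conv_norm_at_top filterlim_at_top_dense by blast
  with 1 have "eventually (\<lambda>z. False) (at s)" by eventually_elim simp
  then show False by simp
qed

text \<open>A meromorphic function \<open>f\<close> that is analytic on \<open>A\<close> and equals \<open>f0\<close> there agrees with the chosen
  continuation near every point of \<open>U\<close>, except possibly at the point itself; at points where \<open>f\<close> is
  analytic no exception is needed.\<close>

lemma meromorphic_continuation_unique:
  assumes U: "open U" "connected U" and A: "open A" "A \<noteq> {}" "A \<subseteq> U"
    and f: "f meromorphic_on U" "\<And>s. s \<in> A \<Longrightarrow> f analytic_on {s}" "\<And>s. s \<in> A \<Longrightarrow> f s = f0 s"
  defines "F \<equiv> meromorphic_continuation f0 A U"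
  shows "z \<in> U \<Longrightarrow> eventually (\<lambda>w. F w = f w) (at z)"
    and "z \<in> U \<Longrightarrow> f analytic_on {z} \<Longrightarrow> F z = f z"
proof -
  have "continues_to f0 A U (remove_sings f)"
    unfolding continues_to_def using A f remove_sings_nicely_meromorphic[OF f(1)] by simp
  then have F: "continues_to f0 A U F"
    unfolding F_def meromorphic_continuation_def by (rule someI[where P = "continues_to f0 A U"])
  then have nice: "F nicely_meromorphic_on U" and FA: "\<And>s. s \<in> A \<Longrightarrow> F s = f s"
    using f(3) by (auto simp: continues_to_def)
  then have mero: "F meromorphic_on U" by (simp add: nicely_meromorphic_on_def)
  have mD: "(\<lambda>z. F z - f z) meromorphic_on U" using mero f(1) by (rule meromorphic_on_diff)
  have "\<not> eventually (\<lambda>z. F z - f z \<noteq> 0) (cosparse U)"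
  proof
    assume ev: "eventually (\<lambda>z. F z - f z \<noteq> 0) (cosparse U)"
    obtain a where a: "a \<in> A" using A by blast
    then have "eventually (\<lambda>z. F z - f z \<noteq> 0) (at a)"
      using ev A U(1) by (auto simp: eventually_cosparse_open_eq)
    moreover have "eventually (\<lambda>z. z \<in> A) (at a)" using A(1) a by (rule eventually_at_in_open')
    ultimately have "eventually (\<lambda>z. False) (at a)" by eventually_elim (auto simp: FA)
    then show False by simp
  qed
  then have "eventually (\<lambda>z. F z - f z = 0) (cosparse U)"
    using meromorphic_imp_constant_or_avoid[OF mD U] by blast
  then have ev: "eventually (\<lambda>w. F w = f w) (at z)" if "z \<in> U" for z
    using that U(1) by (simp add: eventually_cosparse_open_eq)
  then show "z \<in> U \<Longrightarrow> eventually (\<lambda>w. F w = f w) (at z)" .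
  assume z: "z \<in> U" and an: "f analytic_on {z}"
  have "f \<midarrow>z\<rightarrow> f z" using an by (intro isContD analytic_at_imp_isCont)
  then have lim: "F \<midarrow>z\<rightarrow> f z" using tendsto_cong[OF ev[OF z]] by blast
  then have "\<not> is_pole F z" using not_tendsto_and_filterlim_at_infinity[of "at z"] by (auto simp: is_pole_def)
  then have "F \<midarrow>z\<rightarrow> F z" using nice z by (auto simp: nicely_meromorphic_on_def)
  then show "F z = f z" using lim by (rule LIM_unique)
qed

section \<open>The spray volume as a vertical integral\<close>

text \<open>The factor of the tubular zeta function that depends on the generator only, already in the
  form in which the summand of index \<open>d\<close> has cancelled. For a monophase generator with inradius
  \<open>g\<close> it is the Mellin transform of the inner volume at \<open>s - d\<close>, continued meromorphically.\<close>

definition steiner_kernel :: "nat \<Rightarrow> real \<Rightarrow> (nat \<Rightarrow> real) \<Rightarrow> complex \<Rightarrow> complex" where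
  "steiner_kernel d g \<kappa> s =
     (\<Sum>k<d. of_real g powr (s - of_nat k) / (s - of_nat k) * of_nat (d - k) * of_real (\<kappa> k)) / (of_nat d - s)"

text \<open>The volume of the generator enters here as the value of the Steiner polynomial at the
  inradius \<open>g\<close>; combining the fractions with denominators \<open>s - k\<close> and \<open>s - d\<close> gains one order of decay.\<close>

lemma steiner_kernel_eq:
  assumes g: "g > 0" and s: "s \<notin> of_nat ` {0..d}"
  shows "(\<Sum>k\<le>d. of_real g powr (s - of_nat k) / (s - of_nat k) * of_real (\<kappa> k))
       - of_real g powr (s - of_nat d) / (s - of_nat d) * of_real (\<Sum>k\<le>d. \<kappa> k * g ^ (d - k))
       = steiner_kernel d g \<kappa> s"
proof -
  have nz: "s - of_nat k \<noteq> 0" if "k \<le> d" for k using s that by auto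
  have pw: "of_real g powr (s - of_nat d) * of_real (g ^ (d - k)) = of_real g powr (s - of_nat k)" if "k \<le> d" for k
  proof -
    have "of_real (g ^ (d - k)) = complex_of_real g powr (of_nat (d - k))"
      using g by (simp add: powr_nat')
    moreover have "s - of_nat k = (s - of_nat d) + of_nat (d - k)" using that by (simp add: of_nat_diff)
    ultimately show ?thesis by (simp only: powr_add)
  qed
  have "(\<Sum>k\<le>d. of_real g powr (s - of_nat k) / (s - of_nat k) * of_real (\<kappa> k))
       - of_real g powr (s - of_nat d) / (s - of_nat d) * of_real (\<Sum>k\<le>d. \<kappa> k * g ^ (d - k))
       = (\<Sum>k\<le>d. of_real g powr (s - of_nat k) / (s - of_nat k) * of_real (\<kappa> k)
            - of_real g powr (s - of_nat d) * of_real (g ^ (d - k)) / (s - of_nat d) * of_real (\<kappa> k))"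
    by (simp add: sum_distrib_left sum_subtractf mult_ac)
  also have "\<dots> = (\<Sum>k\<le>d. of_real g powr (s - of_nat k) / (s - of_nat k) * of_nat (d - k) * of_real (\<kappa> k) / (of_nat d - s))"
  proof (rule sum.cong[OF refl])
    fix k assume "k \<in> {..d}"
    then have k: "k \<le> d" by simp
    define X where "X = complex_of_real g powr (s - of_nat k)"
    have e: "of_nat (d - k) = (of_nat d - of_nat k :: complex)" using k by (simp add: of_nat_diff)
    have n1: "s - of_nat k \<noteq> 0" "s - of_nat d \<noteq> 0" "of_nat d - s \<noteq> 0" using nz[OF k] nz[of d] by auto
    have "X / (s - of_nat k) * of_real (\<kappa> k) - X / (s - of_nat d) * of_real (\<kappa> k)
        = X / (s - of_nat k) * (of_nat d - of_nat k) * of_real (\<kappa> k) / (of_nat d - s)"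
      using n1 by (simp add: divide_simps) (simp add: algebra_simps)
    then show "of_real g powr (s - of_nat k) / (s - of_nat k) * of_real (\<kappa> k)
            - of_real g powr (s - of_nat d) * of_real (g ^ (d - k)) / (s - of_nat d) * of_real (\<kappa> k)
       = of_real g powr (s - of_nat k) / (s - of_nat k) * of_nat (d - k) * of_real (\<kappa> k) / (of_nat d - s)"
      unfolding pw[OF k] e X_def .
  qed
  also have "\<dots> = (\<Sum>k<d. of_real g powr (s - of_nat k) / (s - of_nat k) * of_nat (d - k) * of_real (\<kappa> k) / (of_nat d - s))"
    by (rule sum.mono_neutral_right) auto
  also have "\<dots> = steiner_kernel d g \<kappa> s"
    by (simp add: steiner_kernel_def sum_divide_distrib)
  finally show ?thesis .
qed

lemma steiner_kernel_analytic:
  assumes g: "g > 0" and s: "s \<notin> of_nat ` {0..d}"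
  shows "steiner_kernel d g \<kappa> analytic_on {s}"
proof -
  have "s - of_nat k \<noteq> 0" if "k \<le> d" for k using s that by auto
  moreover have "of_nat d - s \<noteq> 0" using s by auto
  ultimately show ?thesis
    unfolding steiner_kernel_def[abs_def] using g by (intro analytic_intros) auto
qed

lemma steiner_kernel_meromorphic:
  assumes g: "g > 0" shows "steiner_kernel d g \<kappa> meromorphic_on A"
proof -
  have "(\<lambda>s. complex_of_real g powr (s - of_nat k)) analytic_on A" for k
    using g by (intro analytic_intros) auto
  then show ?thesis
    unfolding steiner_kernel_def[abs_def]
    by (intro meromorphic_intros analytic_on_imp_meromorphic_on) (auto intro!: analytic_intros)
qed

lemma steiner_kernel_bound:
  assumes g: "g > 0"
  obtains C where "C > 0" "\<And>s. \<bar>Re s\<bar> \<le> B \<Longrightarrow> \<bar>Im s\<bar> \<ge> 1 \<Longrightarrow> norm (steiner_kernel d g \<kappa> s) \<le> C * \<bar>Im s\<bar> powr (- 2)"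
proof -
  define E where "E = exp ((B + real d) * \<bar>ln g\<bar>)"
  define C where "C = (\<Sum>k<d. E * real (d - k) * \<bar>\<kappa> k\<bar>) + 1"
  have E: "E > 0" by (simp add: E_def)
  have "0 \<le> (\<Sum>k<d. E * real (d - k) * \<bar>\<kappa> k\<bar>)" using E by (intro sum_nonneg) auto
  then have C: "C > 0" by (simp add: C_def)
  have "norm (steiner_kernel d g \<kappa> s) \<le> C * \<bar>Im s\<bar> powr (- 2)" if s: "\<bar>Re s\<bar> \<le> B" "\<bar>Im s\<bar> \<ge> 1" for s
  proof -
    define t where "t = \<bar>Im s\<bar>"
    have t: "t \<ge> 1" using s by (simp add: t_def)
    have far: "t \<le> norm (s - of_nat k)" for k
      using abs_Im_le_cmod[of "s - of_nat k"] by (simp add: t_def)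
    have summand: "norm (of_real g powr (s - of_nat k) / (s - of_nat k) * of_nat (d - k) * of_real (\<kappa> k))
        \<le> E * real (d - k) * \<bar>\<kappa> k\<bar> / t" if k: "k < d" for k
    proof -
      have "norm (complex_of_real g powr (s - of_nat k)) = exp ((Re s - real k) * ln g)"
        using g by (simp add: norm_powr_real_powr powr_def)
      also have "(Re s - real k) * ln g \<le> \<bar>Re s - real k\<bar> * \<bar>ln g\<bar>"
        by (metis abs_ge_self abs_mult)
      also have "\<dots> \<le> (B + real d) * \<bar>ln g\<bar>" using s k by (intro mult_right_mono) auto
      finally have "norm (complex_of_real g powr (s - of_nat k)) \<le> E" by (simp add: E_def)
      then have "norm (complex_of_real g powr (s - of_nat k)) / norm (s - of_nat k) \<le> E / t"
        using far[of k] t E by (intro frac_le) auto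
      then have "norm (complex_of_real g powr (s - of_nat k)) / norm (s - of_nat k) * (real (d - k) * \<bar>\<kappa> k\<bar>)
          \<le> E / t * (real (d - k) * \<bar>\<kappa> k\<bar>)" by (intro mult_right_mono) auto
      then show ?thesis by (simp add: norm_mult norm_divide mult_ac)
    qed
    have "norm (steiner_kernel d g \<kappa> s) \<le> (\<Sum>k<d. E * real (d - k) * \<bar>\<kappa> k\<bar> / t) / norm (of_nat d - s)"
      unfolding steiner_kernel_def norm_divide
      by (intro divide_right_mono order_trans[OF norm_sum sum_mono] summand) auto
    also have "\<dots> \<le> (\<Sum>k<d. E * real (d - k) * \<bar>\<kappa> k\<bar> / t) / t"
      using far[of d] t E by (intro divide_left_mono sum_nonneg mult_pos_pos) (auto simp: norm_minus_commute)
    also have "\<dots> = (C - 1) / t / t" by (simp add: C_def sum_divide_distrib)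
    also have "\<dots> \<le> C / t / t" using t by (intro divide_right_mono) auto
    also have "\<dots> = C * \<bar>Im s\<bar> powr (- 2)"
      using t by (simp add: t_def[symmetric] powr_minus powr_numeral power2_eq_square divide_inverse)
    finally show ?thesis .
  qed
  then show ?thesis using that C by blast
qed

text \<open>The volume of one piece of size \<open>l\<close>, diminished by its total volume, in the form that the
  Perron integral produces: it vanishes as soon as \<open>\<epsilon>\<close> exceeds the inradius \<open>g * l\<close> of the piece.\<close>

lemma scaled_inner_volume_eq:
  fixes G :: "'a::euclidean_space set"
  assumes gen: "generator G" and mono: "monophase_with G \<kappa>" and l: "l > 0" and \<epsilon>: "\<epsilon> > 0"
  defines "d \<equiv> DIM('a)" and "g \<equiv> inradius G"
  defines "y \<equiv> g * l / \<epsilon>"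
  shows "l ^ d * inner_volume G (\<epsilon> / l) - l ^ d * measure lebesgue G
       = (if y \<ge> 1 then \<Sum>k<d. \<kappa> k * \<epsilon> ^ d / g ^ k * (y ^ k - y ^ d) else 0)"
proof (cases "y \<ge> 1")
  case True
  have g: "g > 0" using inradius_bounds(1)[OF gen] by (simp add: g_def)
  have "\<epsilon> / l \<le> g" using True l \<epsilon> by (simp add: y_def field_simps)
  then have V: "inner_volume G (\<epsilon> / l) = (\<Sum>k\<le>d. \<kappa> k * (\<epsilon> / l) ^ (d - k))"
    using mono l \<epsilon> by (simp add: monophase_with_def d_def g_def)
  have M: "measure lebesgue G = (\<Sum>k\<le>d. \<kappa> k * g ^ (d - k))"
    using monophase_at_inradius[OF gen mono] by (simp add: d_def g_def)
  have "l ^ d * inner_volume G (\<epsilon> / l) - l ^ d * measure lebesgue G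
     = (\<Sum>k\<le>d. l ^ d * (\<kappa> k * (\<epsilon> / l) ^ (d - k)) - l ^ d * (\<kappa> k * g ^ (d - k)))"
    unfolding V M by (simp add: sum_distrib_left sum_subtractf)
  also have "\<dots> = (\<Sum>k\<le>d. \<kappa> k * \<epsilon> ^ d / g ^ k * (y ^ k - y ^ d))"
  proof (rule sum.cong[OF refl])
    fix k assume "k \<in> {..d}"
    then obtain m where m: "d = k + m" using le_Suc_ex by auto
    show "l ^ d * (\<kappa> k * (\<epsilon> / l) ^ (d - k)) - l ^ d * (\<kappa> k * g ^ (d - k)) = \<kappa> k * \<epsilon> ^ d / g ^ k * (y ^ k - y ^ d)"
      unfolding m y_def using g l \<epsilon>
      by (simp add: power_add power_divide power_mult_distrib field_simps)
  qed
  also have "\<dots> = (\<Sum>k<d. \<kappa> k * \<epsilon> ^ d / g ^ k * (y ^ k - y ^ d))"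
    by (rule sum.mono_neutral_right) auto
  finally show ?thesis using True by simp
next
  case False
  then have "g \<le> \<epsilon> / l" using l \<epsilon> by (simp add: y_def field_simps)
  then show ?thesis using False inner_volume_eq_measure[OF gen] by (simp add: g_def)
qed

text \<open>The line of integration \<open>Re s = d + 1\<close> lies to the right of the pole at \<open>d\<close>. This is why each
  piece contributes its inner volume minus its total volume, and why the total volume of the spray,
  the volume of the generator times the value of the string zeta function at \<open>d\<close>, appears
  separately. Integration is done term by term in the series over the pieces.\<close>

lemma spray_volume_vertical_integral:
  fixes G :: "'a::euclidean_space set"
  assumes spray: "fractal_spray L G Gs" and ab: "abscissa L < ereal (real DIM('a))"
    and mono: "monophase_with G \<kappa>" and \<epsilon>: "\<epsilon> > 0"
  defines "d \<equiv> DIM('a)" and "g \<equiv> inradius G"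
  defines "h \<equiv> \<lambda>t. of_real \<epsilon> powr (of_nat d - Complex (real d + 1) t) * string_zeta_series L (Complex (real d + 1) t)
       * steiner_kernel d g \<kappa> (Complex (real d + 1) t)"
  shows "integrable lebesgue h"
    and "(LINT t|lebesgue. h t) = 2 * of_real pi *
      (of_real (spray_volume Gs \<epsilon>) - of_real (measure lebesgue G) * string_zeta_series L (of_nat d))"
proof -
  define c where "c = real d + 1"
  have L: "fractal_string L" and gen: "generator G" using spray by (auto simp: fractal_spray_def)
  have g: "g > 0" using inradius_bounds(1)[OF gen] by (simp add: g_def)
  note Lb = fractal_string_bounds[OF L]
  have abc: "abscissa L < ereal c" using ab by (simp add: c_def d_def) (metis ereal_less(2) less_ereal.simps(1) less_trans less_add_one)
  \<comment> \<open>Piece \<open>j\<close> has inradius \<open>g * L j\<close>, so \<open>y j \<ge> 1\<close> says that \<open>\<epsilon>\<close> is at most its inradius.\<close>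
  define y where "y j = g * L j / \<epsilon>" for j
  have y: "y j > 0" for j using g Lb(1)[of j] \<epsilon> by (simp add: y_def)
  define summand where "summand j t = of_real \<epsilon> powr (of_nat d - Complex c t) * of_real (L j) powr (Complex c t)
       * steiner_kernel d g \<kappa> (Complex c t)" for j t
  define pk where "pk k j t = of_real (y j) powr Complex c t /
     ((Complex c t - of_real (real k)) * (Complex c t - of_real (real d)))" for k j t
  define coef where "coef k = complex_of_real (- real (d - k) * \<kappa> k * \<epsilon> ^ d / g ^ k)" for k
  have summand_eq: "summand j t = (\<Sum>k<d. coef k * pk k j t)" for j t
  proof -
    define s where "s = Complex c t"
    have nz: "s - of_nat k \<noteq> 0" if "k \<le> d" for k
      using that by (auto simp: s_def c_def complex_eq_iff)
    have "summand j t = (\<Sum>k<d. of_real \<epsilon> powr (of_nat d - s) * of_real (L j) powr s *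
        (of_real g powr (s - of_nat k) / (s - of_nat k) * of_nat (d - k) * of_real (\<kappa> k) / (of_nat d - s)))"
      by (simp add: summand_def s_def steiner_kernel_def sum_divide_distrib sum_distrib_left)
    also have "\<dots> = (\<Sum>k<d. coef k * pk k j t)"
    proof (rule sum.cong[OF refl])
      fix k assume "k \<in> {..<d}"
      then have k: "k < d" by simp
      have lny: "ln (y j) = ln g + ln (L j) - ln \<epsilon>"
        using g Lb(1)[of j] \<epsilon> by (simp add: y_def ln_mult ln_div)
      have pe: "of_real a powr z = exp (z * of_real (ln a))" if "a > 0" for a :: real and z :: complex
        using that by (simp add: powr_def Ln_of_real)
      have np: "complex_of_real (a ^ n) = exp (of_nat n * of_real (ln a))" if "a > 0" for a :: real and n
        using that by (simp add: exp_of_nat_mult exp_of_real)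
      have "of_real \<epsilon> powr (of_nat d - s) * of_real (L j) powr s * of_real g powr (s - of_nat k)
          = exp ((of_nat d - s) * of_real (ln \<epsilon>) + s * of_real (ln (L j)) + (s - of_nat k) * of_real (ln g))"
        using \<epsilon> g Lb(1)[of j] by (simp add: pe exp_add)
      also have "(of_nat d - s) * of_real (ln \<epsilon>) + s * of_real (ln (L j)) + (s - of_nat k) * of_real (ln g)
          = of_nat d * of_real (ln \<epsilon>) + s * of_real (ln (y j)) - of_nat k * of_real (ln g)"
        unfolding lny by (simp add: algebra_simps)
      also have "exp \<dots> = of_real (\<epsilon> ^ d) * of_real (y j) powr s / of_real (g ^ k)"
        unfolding pe[OF y] np[OF \<epsilon>] np[OF g] exp_diff exp_add ..
      finally have E: "of_real \<epsilon> powr (of_nat d - s) * of_real (L j) powr s * of_real g powr (s - of_nat k)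
          = of_real (\<epsilon> ^ d) * of_real (y j) powr s / of_real (g ^ k)" .
      have "of_real \<epsilon> powr (of_nat d - s) * of_real (L j) powr s *
        (of_real g powr (s - of_nat k) / (s - of_nat k) * of_nat (d - k) * of_real (\<kappa> k) / (of_nat d - s))
        = (of_real \<epsilon> powr (of_nat d - s) * of_real (L j) powr s * of_real g powr (s - of_nat k))
          * of_nat (d - k) * of_real (\<kappa> k) / ((s - of_nat k) * (of_nat d - s))"
        by simp
      also have "\<dots> = coef k * pk k j t"
        unfolding E coef_def pk_def s_def[symmetric]
        using nz[of k] nz[of d] k g by (simp add: divide_simps) (simp add: algebra_simps)
      finally show "of_real \<epsilon> powr (of_nat d - s) * of_real (L j) powr s *
        (of_real g powr (s - of_nat k) / (s - of_nat k) * of_nat (d - k) * of_real (\<kappa> k) / (of_nat d - s))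
        = coef k * pk k j t" .
    qed
    finally show ?thesis .
  qed
  have pk: "integrable lebesgue (pk k j)" 
     "(LINT t|lebesgue. pk k j t) = (if y j \<ge> 1 then 2 * of_real pi * of_real ((y j powr real d - y j powr real k) / (real d - real k)) else 0)"
    if "k < d" for k j
    unfolding pk_def using that y[of j]
    by (intro perron_kernel; simp add: c_def)+
  have int: "integrable lebesgue (summand j)" for j
    unfolding summand_eq[abs_def] using pk(1) by (intro Bochner_Integration.integrable_sum integrable_mult_right) auto
  have val: "(LINT t|lebesgue. summand j t) = 2 * of_real pi *
      of_real (L j ^ d * inner_volume G (\<epsilon> / L j) - L j ^ d * measure lebesgue G)" for j
  proof -
    have "(LINT t|lebesgue. summand j t) = (\<Sum>k<d. coef k * (LINT t|lebesgue. pk k j t))"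
      unfolding summand_eq[abs_def] using pk(1)
      by (subst Bochner_Integration.integral_sum) auto
    also have "\<dots> = (\<Sum>k<d. if y j \<ge> 1 then 2 * of_real pi * of_real (\<kappa> k * \<epsilon> ^ d / g ^ k * (y j ^ k - y j ^ d)) else 0)"
    proof (rule sum.cong[OF refl])
      fix k assume "k \<in> {..<d}"
      then have k: "k < d" by simp
      have e: "real (d - k) = real d - real k" "real d - real k \<noteq> 0" using k by (simp_all add: of_nat_diff)
      have "- real (d - k) * \<kappa> k * \<epsilon> ^ d / g ^ k * ((y j ^ d - y j ^ k) / (real d - real k))
          = \<kappa> k * \<epsilon> ^ d / g ^ k * (y j ^ k - y j ^ d)"
        unfolding e(1) using e(2) g by (simp add: divide_simps) (simp add: algebra_simps)
      then have "coef k * of_real ((y j powr real d - y j powr real k) / (real d - real k)) = of_real (\<kappa> k * \<epsilon> ^ d / g ^ k * (y j ^ k - y j ^ d))"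
        unfolding coef_def powr_realpow[OF y] of_real_mult[symmetric] by (rule arg_cong)
      then show "coef k * (LINT t|lebesgue. pk k j t) =
         (if y j \<ge> 1 then 2 * of_real pi * of_real (\<kappa> k * \<epsilon> ^ d / g ^ k * (y j ^ k - y j ^ d)) else 0)"
        unfolding pk(2)[OF k] by (simp only: mult.left_commute[of "coef k"] if_distrib[of "(*) (coef k)"] mult_zero_right)
    qed
    also have "\<dots> = 2 * of_real pi * of_real (if y j \<ge> 1 then \<Sum>k<d. \<kappa> k * \<epsilon> ^ d / g ^ k * (y j ^ k - y j ^ d) else 0)"
      by (simp only: of_real_sum sum_distrib_left split: if_split) simp
    also have "(if y j \<ge> 1 then \<Sum>k<d. \<kappa> k * \<epsilon> ^ d / g ^ k * (y j ^ k - y j ^ d) else 0)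
        = L j ^ d * inner_volume G (\<epsilon> / L j) - L j ^ d * measure lebesgue G"
      using scaled_inner_volume_eq[OF gen mono Lb(1) \<epsilon>, of j] by (simp add: d_def g_def y_def)
    finally show ?thesis .
  qed
  define q where "q t = \<epsilon> powr (real d - c) * norm (steiner_kernel d g \<kappa> (Complex c t))" for t
  have nt: "norm (summand j t) = L j powr c * q t" for j t
    using \<epsilon> Lb(1)[of j] by (simp add: summand_def q_def norm_mult norm_powr_real_powr)
  have sL: "summable (\<lambda>j. L j powr c)" by (rule summable_powr_abscissa[OF L abc])
  have h_sum: "h t = (\<Sum>j. summand j t)" for t
  proof -
    have "summable (\<lambda>j. norm (complex_of_real (L j) powr Complex c t))"
      by (rule string_zeta_series_bound(1)[OF L abc]) simp
    then have "summable (\<lambda>j. complex_of_real (L j) powr Complex c t)" by (rule summable_norm_cancel)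
    then show ?thesis
      unfolding h_def summand_def string_zeta_series_def c_def[symmetric]
      by (simp add: suminf_mult suminf_mult2[symmetric] summable_mult)
  qed
  have A1: "AE t in lebesgue. summable (\<lambda>j. norm (summand j t))"
    unfolding nt by (intro AE_I2 summable_mult2 sL)
  have A2: "summable (\<lambda>j. LINT t|lebesgue. norm (summand j t))"
    unfolding nt integral_mult_right_zero by (intro summable_mult2 sL)
  show "integrable lebesgue h"
    unfolding h_sum[abs_def] by (rule integrable_suminf[OF int A1 A2])
  have s1: "(\<lambda>j. LINT t|lebesgue. summand j t) sums (LINT t|lebesgue. h t)"
    unfolding h_sum by (rule sums_integral[OF int A1 A2])
  have sd: "summable (\<lambda>j. L j ^ d)"
  proof -
    have "summable (\<lambda>j. L j powr real d)" by (rule summable_powr_abscissa[OF L]) (use ab d_def in simp)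
    then show ?thesis by (simp add: powr_realpow[OF Lb(1)])
  qed
  have s2: "(\<lambda>j. L j ^ d * inner_volume G (\<epsilon> / L j) - L j ^ d * measure lebesgue G) sums
      (spray_volume Gs \<epsilon> - (\<Sum>j. L j ^ d) * measure lebesgue G)"
    by (intro sums_diff sums_mult2 summable_sums[OF sd] spray_volume_sums[OF spray sd[unfolded d_def], folded d_def])
  have "(\<lambda>j. LINT t|lebesgue. summand j t) sums
      (2 * of_real pi * of_real (spray_volume Gs \<epsilon> - (\<Sum>j. L j ^ d) * measure lebesgue G))"
    unfolding val by (intro sums_mult sums_of_real s2)
  then have "(LINT t|lebesgue. h t) = 2 * of_real pi * of_real (spray_volume Gs \<epsilon> - (\<Sum>j. L j ^ d) * measure lebesgue G)"
    by (rule sums_unique2[OF s1])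
  moreover have "string_zeta_series L (of_nat d) = of_real (\<Sum>j. L j ^ d)"
    unfolding string_zeta_series_def using Lb(1) sd
    by (simp add: suminf_of_real powr_nat' less_imp_neq[THEN not_sym])
  ultimately show "(LINT t|lebesgue. h t) = 2 * of_real pi *
      (of_real (spray_volume Gs \<epsilon>) - of_real (measure lebesgue G) * string_zeta_series L (of_nat d))"
    by (simp add: mult.commute)
qed

section \<open>The tube formula\<close>

text \<open>Near a pole the function would be unbounded on the half-line to which the first languidness
  bound applies, even though the value at the pole itself is 0.\<close>

lemma languid_no_pole:
  assumes "languid_along T \<zeta> S \<tau>" and x: "S (T n) \<le> x"
  shows "\<not> is_pole \<zeta> (Complex x (T n))"
proof
  assume pole: "is_pole \<zeta> (Complex x (T n))"
  obtain c where c: "\<And>\<alpha>. \<alpha> \<ge> S (T n) \<Longrightarrow> norm (\<zeta> (Complex \<alpha> (T n))) \<le> c * (\<bar>T n\<bar> + 1) powr \<tau>"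
    using assms(1) unfolding languid_along_def by blast
  define B where "B = c * (\<bar>T n\<bar> + 1) powr \<tau>"
  have "eventually (\<lambda>z. norm (\<zeta> z) > B) (at (Complex x (T n)))"
    using pole unfolding is_pole_def filterlim_at_infinity_conv_norm_at_top filterlim_at_top_dense by blast
  then obtain \<delta> where \<delta>: "\<delta> > 0"
    "\<And>z. z \<noteq> Complex x (T n) \<Longrightarrow> dist z (Complex x (T n)) < \<delta> \<Longrightarrow> norm (\<zeta> z) > B"
    unfolding eventually_at by auto
  have "dist (Complex (x + \<delta> / 2) (T n)) (Complex x (T n)) = \<delta> / 2"
    using \<delta>(1) by (simp add: dist_complex_def complex_diff cmod_def)
  then have "norm (\<zeta> (Complex (x + \<delta> / 2) (T n))) > B" using \<delta> by (intro \<delta>(2)) auto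
  moreover have "norm (\<zeta> (Complex (x + \<delta> / 2) (T n))) \<le> B"
    unfolding B_def using x \<delta>(1) by (intro c) simp
  ultimately show False by simp
qed

lemma tubular_zeta_series_eq:
  fixes G :: "'a::euclidean_space set"
  assumes L: "fractal_string L" and gen: "generator G" and mono: "monophase_with G \<kappa>"
    and s: "s \<in> convergence_halfplane L - of_nat ` {0..DIM('a)}"
  shows "tubular_zeta_series G (\<lambda>k _. \<kappa> k) L \<epsilon> s
    = of_real \<epsilon> powr (of_nat DIM('a) - s) * string_zeta_series L s * steiner_kernel DIM('a) (inradius G) \<kappa> s"
proof -
  obtain \<sigma> where \<sigma>: "abscissa L < ereal \<sigma>" "\<sigma> < Re s"
    using convergence_halfplane_margin[OF L] s by blast
  then have "summable (\<lambda>j. norm (complex_of_real (L j) powr s))"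
    by (intro string_zeta_series_bound(1)[OF L \<sigma>(1)]) simp
  then have sm: "summable (\<lambda>j. complex_of_real (L j) powr s)" by (rule summable_norm_cancel)
  have "s \<notin> of_nat ` {0..DIM('a)}" using s by blast
  note k = steiner_kernel_eq[OF inradius_bounds(1)[OF gen] this, of \<kappa>, folded monophase_at_inradius[OF gen mono]]
  show ?thesis
    unfolding tubular_zeta_series_def Let_def k string_zeta_series_def suminf_mult2[OF sm, symmetric]
    by (simp only: mult.assoc)
qed

theorem corollary4p2:
  fixes G :: "'a::euclidean_space set"
    and Gs :: "nat \<Rightarrow> 'a set"
    and L :: "nat \<Rightarrow> real"
    and \<kappa> :: "nat \<Rightarrow> real"
    and S :: "real \<Rightarrow> real"
    and U :: "complex set"
    and T :: "int \<Rightarrow> real"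
    and \<tau> :: real
  defines "d \<equiv> DIM('a)"
    and "g \<equiv> inradius G"
    and "\<zeta>\<^sub>L \<equiv> string_zeta L U"
    and "\<zeta>\<^sub>T \<equiv> tubular_zeta G (\<lambda>k _. \<kappa> k) L U"
  assumes spray: "fractal_spray L G Gs"
    and abscissa: "abscissa L < ereal (real d)"
    and monophase: "monophase_with G \<kappa>"
    and screen: "screen L U S"
    and avoids: "\<And>k t. k \<le> d \<Longrightarrow> Complex (S t) t \<noteq> of_nat k"
    and languid: "languid_along T \<zeta>\<^sub>L S \<tau>" "\<tau> < 1"
  shows "\<exists>\<R> :: real \<Rightarrow> complex.
     (\<forall>\<epsilon>>0. \<exists>\<sigma>. has_dims_sum T (spray_dims d L U S) (\<lambda>\<omega>. residue (\<zeta>\<^sub>T \<epsilon>) \<omega>) \<sigma> \<and>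
        of_real (spray_volume Gs \<epsilon>) =
          \<sigma> + of_real (measure lebesgue G) * \<zeta>\<^sub>L (of_nat d) + \<R> \<epsilon>) \<and>
     (\<lambda>\<epsilon>. norm (\<R> \<epsilon>)) \<in> O[at_right 0](\<lambda>\<epsilon>. \<epsilon> powr (real d - Sup (range S))) \<and>
     (\<forall>\<epsilon>>0. \<exists>I. has_screen_integral S (\<zeta>\<^sub>T \<epsilon>) I \<and> \<R> \<epsilon> = 1 / (2 * of_real pi * \<i>) * I) \<and>
     (\<forall>\<epsilon>>0. \<exists>I. has_screen_integral S
          (\<lambda>s. of_real \<epsilon> powr (of_nat d - s) * \<zeta>\<^sub>L s / (of_nat d - s) *
             (\<Sum>k<d. of_real g powr (s - of_nat k) / (s - of_nat k) *
                      of_nat (d - k) * of_real (\<kappa> k))) I \<and>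
        \<R> \<epsilon> = 1 / (2 * of_real pi * \<i>) * I)"
proof -
  have L: "fractal_string L" and gen: "generator G" using spray by (auto simp: fractal_spray_def)
  have g: "g > 0" using inradius_bounds(1)[OF gen] by (simp add: g_def)
  obtain K where lip: "K-lipschitz_on UNIV S" using screen by (auto simp: screen_def)
  obtain B where B: "\<And>t. \<bar>S t\<bar> \<le> B" and B0: "B > 0"
    using screen unfolding screen_def bounded_pos by auto
  have U: "open U" "connected U" "window S \<subseteq> U" using screen by (auto simp: screen_def)
  have cont: "continues_to (string_zeta_series L) (convergence_halfplane L) U \<zeta>\<^sub>L"
    unfolding \<zeta>\<^sub>L_def by (rule string_zeta_continues[OF screen])
  have half_U: "convergence_halfplane L \<subseteq> U" and nice: "\<zeta>\<^sub>L nicely_meromorphic_on U"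
    and ser: "\<And>s. s \<in> convergence_halfplane L \<Longrightarrow> \<zeta>\<^sub>L s = string_zeta_series L s"
    using cont by (auto simp: continues_to_def)
  have mero: "\<zeta>\<^sub>L meromorphic_on U" using nice by (simp add: nicely_meromorphic_on_def)
  have half: "s \<in> convergence_halfplane L" if "Re s \<ge> real d" for s
    using abscissa that unfolding convergence_halfplane_def by (auto intro: less_le_trans)
  have nopole: "\<not> is_pole \<zeta>\<^sub>L s" if "Re s \<ge> real d" for s
    using string_zeta_no_pole_halfplane[OF L screen half[OF that]] by (simp add: \<zeta>\<^sub>L_def)
  \<comment> \<open>The right edge of the contour, beyond the abscissa of convergence and all integers up to \<open>d\<close>.\<close>
  define c where "c = real d + 1"
  have Sd: "S t < real d" for t
    using screen abscissa unfolding screen_def by (metis ereal_less_eq(3) le_less_trans less_ereal.simps(1))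
  have Sc: "S t < c" for t using Sd[of t] by (simp add: c_def)

  \<comment> \<open>The singularities of the integrand: the poles of the string zeta function and the integers at which
    the kernel may have a pole.\<close>
  define P where "P = {z \<in> U. is_pole \<zeta>\<^sub>L z} \<union> of_nat ` {0..d}"
  have P: "P sparse_in U"
  proof -
    have "{z. is_pole \<zeta>\<^sub>L z} sparse_in U"
      using meromorphic_on_imp_not_pole_cosparse[OF mero] by (simp add: eventually_cosparse)
    then have "{z \<in> U. is_pole \<zeta>\<^sub>L z} sparse_in U" by (rule sparse_in_subset2) auto
    moreover have "(of_nat ` {0..d} :: complex set) sparse_in U" by (rule finite_imp_sparse) simp
    ultimately show ?thesis unfolding P_def by (rule sparse_in_union')
  qed
  have P_pole: "is_pole \<zeta>\<^sub>L p \<or> (\<exists>k\<le>d. p = of_nat k)" if "p \<in> P" for p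
    using that by (auto simp: P_def)
  have P_Re: "Re p \<le> real d" if "p \<in> P" for p
    using P_pole[OF that] nopole[of p] by fastforce
  have c_P: "Complex c t \<notin> P" for t using P_Re[of "Complex c t"] by (auto simp: c_def)
  have S_P: "Complex (S t) t \<notin> P" for t
    using P_pole[of "Complex (S t) t"] avoids screen by (auto simp: screen_def \<zeta>\<^sub>L_def)
  have S_UP: "Complex (S t) t \<in> U - P" for t using U(3) S_P by (auto simp: window_def)
  have \<zeta>_an: "\<zeta>\<^sub>L analytic_on {z}" if "z \<in> U - P" for z
    using nicely_meromorphic_on_imp_analytic_at[OF nice] that by (auto simp: P_def)
  have k_an: "steiner_kernel d g \<kappa> analytic_on {z}" if "z \<in> U - P" for z
    using that by (intro steiner_kernel_analytic[OF g]) (auto simp: P_def)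

  define f where "f \<epsilon> s = of_real \<epsilon> powr (of_nat d - s) * \<zeta>\<^sub>L s * steiner_kernel d g \<kappa> s" for \<epsilon> s
  have f_an: "f \<epsilon> analytic_on {z}" if "z \<in> U - P" "\<epsilon> > 0" for \<epsilon> z
    unfolding f_def[abs_def] using that by (intro analytic_intros \<zeta>_an k_an) auto
  have f_holo: "f \<epsilon> holomorphic_on U - P" if "\<epsilon> > 0" for \<epsilon>
    using f_an that by (metis analytic_imp_holomorphic analytic_on_analytic_at)
  have f_mero: "f \<epsilon> meromorphic_on U" if "\<epsilon> > 0" for \<epsilon>
  proof -
    have "(\<lambda>s. complex_of_real \<epsilon> powr (of_nat d - s)) analytic_on U"
      using that by (intro analytic_intros) auto
    then show ?thesis
      unfolding f_def[abs_def]
      by (intro meromorphic_on_mult mero steiner_kernel_meromorphic[OF g] analytic_on_imp_meromorphic_on)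
  qed
  define A where "A = convergence_halfplane L - of_nat ` {0..d}"
  have A: "open A" "A \<noteq> {}" "A \<subseteq> U"
  proof -
    show "open A" unfolding A_def
      by (intro open_Diff open_convergence_halfplane finite_imp_closed) simp
    have "Complex c 0 \<in> A" using half[of "Complex c 0"] by (auto simp: A_def c_def complex_eq_iff)
    then show "A \<noteq> {}" by blast
    show "A \<subseteq> U" using half_U by (auto simp: A_def)
  qed
  have A_P: "s \<in> U - P" if "s \<in> A" for s
    using that A(3) P_pole[of s] string_zeta_no_pole_halfplane[OF L screen, of s]
    by (auto simp: A_def \<zeta>\<^sub>L_def)
  have f_series: "f \<epsilon> s = tubular_zeta_series G (\<lambda>k _. \<kappa> k) L \<epsilon> s" if "s \<in> A" for \<epsilon> s
    using tubular_zeta_series_eq[OF L gen monophase, of s \<epsilon>] ser[of s] that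
    by (simp add: f_def A_def d_def g_def)
  note uniq = meromorphic_continuation_unique[OF U(1,2) A f_mero f_an[OF A_P] f_series]
  have \<zeta>T_eq: "\<zeta>\<^sub>T \<epsilon> = meromorphic_continuation (tubular_zeta_series G (\<lambda>k _. \<kappa> k) L \<epsilon>) A U" for \<epsilon>
    by (simp add: \<zeta>\<^sub>T_def tubular_zeta_def A_def d_def)
  have res_eq: "residue (\<zeta>\<^sub>T \<epsilon>) \<omega> = residue (f \<epsilon>) \<omega>" if "\<omega> \<in> U" "\<epsilon> > 0" for \<epsilon> \<omega>
    unfolding \<zeta>T_eq by (intro residue_cong uniq(1) refl) (use that in auto)
  have \<zeta>T_screen: "screen_integrand S (\<zeta>\<^sub>T \<epsilon>) = screen_integrand S (f \<epsilon>)" if "\<epsilon> > 0" for \<epsilon>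
  proof
    fix t
    have "\<zeta>\<^sub>T \<epsilon> (Complex (S t) t) = f \<epsilon> (Complex (S t) t)"
      unfolding \<zeta>T_eq using S_UP that by (intro uniq(2) f_an) auto
    then show "screen_integrand S (\<zeta>\<^sub>T \<epsilon>) t = screen_integrand S (f \<epsilon>) t"
      by (simp add: screen_integrand_def)
  qed

  obtain c0 where c0: "c0 > 0"
    "\<And>n \<alpha>. \<alpha> \<ge> S (T n) \<Longrightarrow> norm (\<zeta>\<^sub>L (Complex \<alpha> (T n))) \<le> c0 * (\<bar>T n\<bar> + 1) powr \<tau>"
    "\<And>t. \<bar>t\<bar> \<ge> 1 \<Longrightarrow> norm (\<zeta>\<^sub>L (Complex (S t) t)) \<le> c0 * \<bar>t\<bar> powr \<tau>"
    using languid(1) unfolding languid_along_def by blast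
  have T: "\<And>n. n \<ge> 1 \<Longrightarrow> T (- n) < 0 \<and> 0 < T n"
    "filterlim (\<lambda>n::nat. T (int n)) at_top sequentially"
    "filterlim (\<lambda>n::nat. T (- int n)) at_bot sequentially"
    using languid(1) by (auto simp: languid_along_def height_sequence_def)
  obtain C where C: "C > 0" "\<And>s. \<bar>Re s\<bar> \<le> B + c \<Longrightarrow> \<bar>Im s\<bar> \<ge> 1 \<Longrightarrow>
      norm (steiner_kernel d g \<kappa> s) \<le> C * \<bar>Im s\<bar> powr (- 2)"
    using steiner_kernel_bound[OF g] by blast
  have cpos: "c > 0" by (simp add: c_def)

  have contS: "continuous_on UNIV (\<lambda>t. Complex (S t) t)"
    using lipschitz_on_continuous_on[OF lip] unfolding Complex_eq by (intro continuous_intros)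
  have cont_screen: "continuous_on UNIV (\<lambda>t. h (Complex (S t) t))"
    if "\<And>z. z \<in> U - P \<Longrightarrow> h analytic_on {z}" for h :: "complex \<Rightarrow> complex"
  proof -
    have "h holomorphic_on U - P" using that by (metis analytic_imp_holomorphic analytic_on_analytic_at)
    then have "continuous_on (U - P) h" by (rule holomorphic_on_imp_continuous_on)
    then show ?thesis using contS by (rule continuous_on_compose2) (use S_UP in blast)
  qed
  \<comment> \<open>The part of the integrand that does not depend on \<open>\<epsilon>\<close> is dominated on the screen, which makes
    the error estimate uniform in \<open>\<epsilon>\<close>.\<close>
  define z where "z t = \<zeta>\<^sub>L (Complex (S t) t) * steiner_kernel d g \<kappa> (Complex (S t) t)" for t
  have z_cont: "continuous_on UNIV z"
    unfolding z_def[abs_def] by (rule continuous_on_mult[OF cont_screen[OF \<zeta>_an] cont_screen[OF k_an]])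
  have z_bd: "norm (z t) \<le> (c0 * C) * \<bar>t\<bar> powr (- (2 - \<tau>))" if t: "\<bar>t\<bar> \<ge> 1" for t
  proof -
    have "norm (z t) \<le> (c0 * \<bar>t\<bar> powr \<tau>) * (C * \<bar>t\<bar> powr (- 2))"
      unfolding z_def norm_mult using c0(3)[OF t] C(2)[of "Complex (S t) t"] t B[of t] cpos c0(1)
      by (intro mult_mono) auto
    also have "\<dots> = (c0 * C) * (\<bar>t\<bar> powr \<tau> * \<bar>t\<bar> powr (- 2))" by simp
    also have "\<bar>t\<bar> powr \<tau> * \<bar>t\<bar> powr (- 2) = \<bar>t\<bar> powr (- (2 - \<tau>))" by (simp flip: powr_add)
    finally show ?thesis .
  qed
  obtain M where M: "M > 0" "\<And>t. norm (z t) \<le> M * decay (2 - \<tau>) t"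
    using decay_bound_continuous[OF z_cont z_bd] by blast
  have p: "2 - \<tau> > 1" using languid(2) by simp
  obtain N where N: "negligible N" "\<And>t. t \<notin> N \<Longrightarrow> \<bar>deriv S t\<bar> \<le> K" and dS: "deriv S \<in> borel_measurable lebesgue"
    using lipschitz_deriv_ae[OF lip] by metis
  have Knn: "K \<ge> 0" using lipschitz_on_nonneg[OF lip] .
  have norm_eps: "norm (complex_of_real \<epsilon> powr (of_nat d - s)) = \<epsilon> powr (real d - Re s)" if "\<epsilon> > 0" for \<epsilon> s
    using that by (simp add: norm_powr_real_powr)
  \<comment> \<open>A bound for \<open>\<epsilon> powr (d - s)\<close> along the screen yields a bound for the whole integrand.\<close>
  have bound_AE: "AE t in lebesgue. norm (screen_integrand S (f \<epsilon>) t) \<le> (E * M * (K + 1)) * decay (2 - \<tau>) t"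
    if "\<epsilon> > 0" and E: "\<And>t. \<epsilon> powr (real d - S t) \<le> E" for \<epsilon> E
  proof (rule AE_I')
    show "N \<in> null_sets lebesgue" using N(1) by (simp add: negligible_iff_null_sets)
    have "norm (screen_integrand S (f \<epsilon>) t) \<le> (E * M * (K + 1)) * decay (2 - \<tau>) t" if t: "t \<notin> N" for t
    proof -
      have "norm (complex_of_real (deriv S t) + \<i>) \<le> K + 1"
        using norm_triangle_ineq[of "complex_of_real (deriv S t)" \<i>] N(2)[OF t] by simp
      moreover have "norm (screen_integrand S (f \<epsilon>) t)
          = \<epsilon> powr (real d - S t) * norm (z t) * norm (complex_of_real (deriv S t) + \<i>)"
        using norm_eps[OF \<open>\<epsilon> > 0\<close>, of "Complex (S t) t"]
        by (simp add: screen_integrand_def f_def z_def norm_mult mult.assoc)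
      moreover have "E \<ge> 0" using E[of 0] by (rule order_trans[rotated]) simp
      ultimately have "norm (screen_integrand S (f \<epsilon>) t) \<le> E * (M * decay (2 - \<tau>) t) * (K + 1)"
        using E M Knn decay_nonneg by (simp add: mult_mono)
      then show ?thesis by (simp add: mult_ac)
    qed
    then show "{t \<in> space lebesgue. \<not> norm (screen_integrand S (f \<epsilon>) t) \<le> (E * M * (K + 1)) * decay (2 - \<tau>) t} \<subseteq> N"
      by blast
  qed
  have eps_B: "\<epsilon> powr (real d - x) \<le> exp ((real d + (B + c)) * \<bar>ln \<epsilon>\<bar>)" if "\<epsilon> > 0" "\<bar>x\<bar> \<le> B + c" for \<epsilon> x
  proof -
    have "(real d - x) * ln \<epsilon> \<le> \<bar>real d - x\<bar> * \<bar>ln \<epsilon>\<bar>" by (metis abs_ge_self abs_mult)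
    also have "\<dots> \<le> (real d + (B + c)) * \<bar>ln \<epsilon>\<bar>" using that by (intro mult_right_mono) auto
    finally show ?thesis using that by (simp add: powr_def)
  qed
  have SB: "\<bar>S t\<bar> \<le> B + c" for t using B[of t] cpos by linarith
  have int: "integrable lebesgue (screen_integrand S (f \<epsilon>))" if \<epsilon>: "\<epsilon> > 0" for \<epsilon>
  proof (rule integrable_decay_bound[OF _ p])
    show "AE t in lebesgue. norm (screen_integrand S (f \<epsilon>) t)
       \<le> (exp ((real d + (B + c)) * \<bar>ln \<epsilon>\<bar>) * M * (K + 1)) * decay (2 - \<tau>) t"
      by (rule bound_AE[OF \<epsilon> eps_B[OF \<epsilon> SB]])
    have "(\<lambda>t. f \<epsilon> (Complex (S t) t)) \<in> borel_measurable lebesgue"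
      by (rule continuous_imp_lebesgue_measurable[OF cont_screen[OF f_an[OF _ \<epsilon>]]])
    moreover have "(\<lambda>t. complex_of_real (deriv S t)) \<in> borel_measurable lebesgue"
      by (rule measurable_compose[OF dS borel_measurable_of_real])
    ultimately show "screen_integrand S (f \<epsilon>) \<in> borel_measurable lebesgue"
      unfolding screen_integrand_def by (intro borel_measurable_times borel_measurable_add) auto
  qed
  define I where "I \<epsilon> = (LINT t|lebesgue. screen_integrand S (f \<epsilon>) t)" for \<epsilon>
  define \<R> where "\<R> \<epsilon> = 1 / (2 * of_real pi * \<i>) * I \<epsilon>" for \<epsilon>
  have hsi: "has_screen_integral S (f \<epsilon>) (I \<epsilon>)" if "\<epsilon> > 0" for \<epsilon>
    using int[OF that] by (simp add: has_screen_integral_def I_def)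

  \<comment> \<open>As \<open>\<tau> < 1\<close>, the zeta function grows at most linearly in the height, which the quadratic decay
    of the kernel outweighs; so the horizontal segments do not contribute in the limit.\<close>
  have hor: "norm (contour_integral (linepath (Complex (S t) t) (Complex c t)) (f \<epsilon>))
       \<le> (2 * exp ((real d + (B + c)) * \<bar>ln \<epsilon>\<bar>) * c0 * C * (B + c)) / \<bar>t\<bar>"
    if \<epsilon>: "\<epsilon> > 0" and t: "t = T n" "\<bar>t\<bar> \<ge> 1" for \<epsilon> t n
  proof -
    define E where "E = exp ((real d + (B + c)) * \<bar>ln \<epsilon>\<bar>)"
    have tpos: "\<bar>t\<bar> > 0" using t by linarith
    have seg: "Im s = t \<and> S t \<le> Re s \<and> Re s \<le> c" if "s \<in> closed_segment (Complex (S t) t) (Complex c t)" for s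
      using that Sc[of t] by (subst (asm) closed_segment_same_Im) (auto simp: closed_segment_eq_real_ivl)
    have bd: "norm (f \<epsilon> s) \<le> 2 * E * c0 * C / \<bar>t\<bar>" if s: "s \<in> closed_segment (Complex (S t) t) (Complex c t)" for s
    proof -
      have sx: "s = Complex (Re s) (T n)" using seg[OF s] t by (simp add: complex_eq_iff)
      have Re: "\<bar>Re s\<bar> \<le> B + c" using seg[OF s] B[of t] cpos by linarith
      have "norm (\<zeta>\<^sub>L s) \<le> c0 * (\<bar>t\<bar> + 1) powr \<tau>"
        using c0(2)[of n "Re s"] seg[OF s] sx t by metis
      also have "(\<bar>t\<bar> + 1) powr \<tau> \<le> (\<bar>t\<bar> + 1) powr 1" using languid(2) by (intro powr_mono) auto
      also have "\<dots> \<le> 2 * \<bar>t\<bar>" using t by simp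
      finally have 1: "norm (\<zeta>\<^sub>L s) \<le> c0 * (2 * \<bar>t\<bar>)" using c0(1) by simp
      have 2: "norm (steiner_kernel d g \<kappa> s) \<le> C * \<bar>t\<bar> powr (- 2)"
        using C(2)[OF Re] seg[OF s] t by simp
      have 3: "norm (complex_of_real \<epsilon> powr (of_nat d - s)) \<le> E"
        unfolding norm_eps[OF \<epsilon>] E_def using \<epsilon> Re by (rule eps_B)
      have "norm (f \<epsilon> s) \<le> E * (c0 * (2 * \<bar>t\<bar>)) * (C * \<bar>t\<bar> powr (- 2))"
        unfolding f_def norm_mult using 1 2 3 c0(1) by (intro mult_mono) (auto simp: E_def)
      also have "\<dots> = 2 * E * c0 * C * (\<bar>t\<bar> * \<bar>t\<bar> powr (- 2))" by simp
      also have "\<bar>t\<bar> * \<bar>t\<bar> powr (- 2) = 1 / \<bar>t\<bar>"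
      proof -
        have "r * r powr (- 2) = 1 / r" if "r > 0" for r :: real
          using that by (simp add: powr_minus powr_numeral power2_eq_square divide_inverse)
        from this[OF tpos] show ?thesis .
      qed
      finally show ?thesis by simp
    qed
    have "closed_segment (Complex (S t) t) (Complex c t) \<subseteq> U - P"
    proof
      fix s assume s: "s \<in> closed_segment (Complex (S t) t) (Complex c t)"
      have "s \<in> U" using seg[OF s] U(3) by (auto simp: window_def)
      moreover have "s \<notin> P"
      proof
        assume "s \<in> P"
        have sx: "s = Complex (Re s) (T n)" using seg[OF s] t by (simp add: complex_eq_iff)
        have "\<not> is_pole \<zeta>\<^sub>L s"
          using languid_no_pole[OF languid(1), of n "Re s"] seg[OF s] sx t by metis
        moreover have "s \<noteq> of_nat k" for k using seg[OF s] tpos by auto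
        ultimately show False using P_pole[OF \<open>s \<in> P\<close>] by blast
      qed
      ultimately show "s \<in> U - P" by blast
    qed
    then have "f \<epsilon> contour_integrable_on linepath (Complex (S t) t) (Complex c t)"
      using f_holo[OF \<epsilon>] by (meson contour_integrable_continuous_linepath continuous_on_subset holomorphic_on_imp_continuous_on)
    then have "norm (contour_integral (linepath (Complex (S t) t) (Complex c t)) (f \<epsilon>))
        \<le> 2 * E * c0 * C / \<bar>t\<bar> * norm (Complex c t - Complex (S t) t)"
      using bd c0(1) C(1) by (intro contour_integral_bound_linepath) (auto simp: E_def)
    also have "norm (Complex c t - Complex (S t) t) = \<bar>c - S t\<bar>" by (simp add: cmod_eq_Re)
    also have "2 * E * c0 * C / \<bar>t\<bar> * \<bar>c - S t\<bar> \<le> 2 * E * c0 * C / \<bar>t\<bar> * (B + c)"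
      using B[of t] cpos c0(1) C(1) by (intro mult_left_mono) (auto simp: E_def)
    finally show ?thesis by (simp add: E_def)
  qed
  have hor0: "(\<lambda>n. contour_integral (linepath (Complex (S (t n)) (t n)) (Complex c (t n))) (f \<epsilon>)) \<longlonglongrightarrow> 0"
    if \<epsilon>: "\<epsilon> > 0" and t: "\<And>n. \<exists>m. t n = T m" "filterlim (\<lambda>n. \<bar>t n\<bar>) at_top sequentially" for \<epsilon> and t :: "nat \<Rightarrow> real"
  proof (rule Lim_null_comparison)
    have "eventually (\<lambda>n. \<bar>t n\<bar> \<ge> 1) sequentially" using t(2) by (simp add: filterlim_at_top)
    then show "\<forall>\<^sub>F n in sequentially. norm (contour_integral (linepath (Complex (S (t n)) (t n)) (Complex c (t n))) (f \<epsilon>))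
       \<le> (2 * exp ((real d + (B + c)) * \<bar>ln \<epsilon>\<bar>) * c0 * C * (B + c)) / \<bar>t n\<bar>"
      by eventually_elim (use hor[OF \<epsilon>] t(1) in blast)
    show "(\<lambda>n. (2 * exp ((real d + (B + c)) * \<bar>ln \<epsilon>\<bar>) * c0 * C * (B + c)) / \<bar>t n\<bar>) \<longlonglongrightarrow> 0"
      by (rule tendsto_divide_0[OF tendsto_const filterlim_at_top_imp_at_infinity[OF t(2)]])
  qed

  define a where "a n = T (- int n)" for n
  define b where "b n = T (int n)" for n
  have ab: "a n < 0" "0 < b n" if "n \<ge> 1" for n
    using T(1)[of "int n"] that by (auto simp: a_def b_def)
  have lim_ab: "filterlim a at_bot sequentially" "filterlim b at_top sequentially"
    unfolding a_def[abs_def] b_def[abs_def] using T by auto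
  have abs_ab: "filterlim (\<lambda>n. \<bar>a n\<bar>) at_top sequentially" "filterlim (\<lambda>n. \<bar>b n\<bar>) at_top sequentially"
  proof -
    have "filterlim (\<lambda>n. - a n) at_top sequentially" using lim_ab(1) by (simp add: filterlim_uminus_at_bot)
    then show "filterlim (\<lambda>n. \<bar>a n\<bar>) at_top sequentially"
      by (rule filterlim_at_top_mono) (auto intro: always_eventually)
    show "filterlim (\<lambda>n. \<bar>b n\<bar>) at_top sequentially"
      using lim_ab(2) by (rule filterlim_at_top_mono) (auto intro: always_eventually)
  qed
  have good: "Complex x t \<notin> P" if "t = T m" "t \<noteq> 0" "S t \<le> x" for x t m
    using P_pole[of "Complex x t"] languid_no_pole[OF languid(1), of m x] that by (auto simp: complex_eq_iff)
  have dims: "{\<omega> \<in> spray_dims d L U S. x < Im \<omega> \<and> Im \<omega> < y}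
      = {p \<in> P. S (Im p) \<le> Re p \<and> Re p \<le> c \<and> x < Im p \<and> Im p < y}" for x y
  proof -
    have "spray_dims d L U S = {p \<in> P. S (Im p) \<le> Re p}"
      using U(3) by (auto simp: spray_dims_def string_dims_def P_def window_def \<zeta>\<^sub>L_def)
    then show ?thesis using P_Re by (force simp: c_def)
  qed
  have strip: "finite {\<omega> \<in> spray_dims d L U S. a n < Im \<omega> \<and> Im \<omega> < b n} \<and>
      contour_integral (linepath (Complex (S (a n)) (a n)) (Complex c (a n))) (f \<epsilon>)
      + \<i> * integral {a n..b n} (\<lambda>t. f \<epsilon> (Complex c t))
      - contour_integral (linepath (Complex (S (b n)) (b n)) (Complex c (b n))) (f \<epsilon>)
      - integral {a n..b n} (screen_integrand S (f \<epsilon>))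
      = 2 * of_real pi * \<i> * (\<Sum>\<omega> | \<omega> \<in> spray_dims d L U S \<and> a n < Im \<omega> \<and> Im \<omega> < b n. residue (f \<epsilon>) \<omega>)"
    if \<epsilon>: "\<epsilon> > 0" and n: "n \<ge> 1" for \<epsilon> n
  proof -
    have lt: "a n < b n" using ab[OF n] by simp
    have ga: "\<forall>x. S (a n) \<le> x \<longrightarrow> x \<le> c \<longrightarrow> Complex x (a n) \<notin> P"
      using good[of "a n" "- int n"] ab[OF n] by (auto simp: a_def)
    have gb: "\<forall>x. S (b n) \<le> x \<longrightarrow> x \<le> c \<longrightarrow> Complex x (b n) \<notin> P"
      using good[of "b n" "int n"] ab[OF n] by (auto simp: b_def)
    have v: "contour_integral (linepath (Complex c (a n)) (Complex c (b n))) (f \<epsilon>)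
        = \<i> * integral {a n..b n} (\<lambda>t. f \<epsilon> (Complex c t))"
      using lt by (intro contour_integral_linepath_same_Re) auto
    from strip_residues[OF lip Sc U(1) P f_holo[OF \<epsilon>] U(3) S_P c_P lt ga gb] show ?thesis
      unfolding v dims by blast
  qed

  have main: "\<exists>\<sigma>. has_dims_sum T (spray_dims d L U S) (\<lambda>\<omega>. residue (\<zeta>\<^sub>T \<epsilon>) \<omega>) \<sigma> \<and>
        of_real (spray_volume Gs \<epsilon>) = \<sigma> + of_real (measure lebesgue G) * \<zeta>\<^sub>L (of_nat d) + \<R> \<epsilon>"
    if \<epsilon>: "\<epsilon> > 0" for \<epsilon>
  proof -
    define V where "V = complex_of_real (spray_volume Gs \<epsilon>) - of_real (measure lebesgue G) * \<zeta>\<^sub>L (of_nat d)"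
    have fc: "f \<epsilon> (Complex c t) = of_real \<epsilon> powr (of_nat d - Complex (real d + 1) t) * string_zeta_series L (Complex (real d + 1) t)
       * steiner_kernel d g \<kappa> (Complex (real d + 1) t)" for t
      using ser[OF half, of "Complex c t"] by (simp add: f_def c_def)
    have vint: "integrable lebesgue (\<lambda>t. f \<epsilon> (Complex c t))"
      "(LINT t|lebesgue. f \<epsilon> (Complex c t)) = 2 * of_real pi * V"
      using spray_volume_vertical_integral[OF spray abscissa[unfolded d_def] monophase \<epsilon>] ser[OF half, of "of_nat d"]
      unfolding fc V_def by (simp_all add: d_def g_def)
    have lhs: "(\<lambda>n. contour_integral (linepath (Complex (S (a n)) (a n)) (Complex c (a n))) (f \<epsilon>)
      + \<i> * integral {a n..b n} (\<lambda>t. f \<epsilon> (Complex c t))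
      - contour_integral (linepath (Complex (S (b n)) (b n)) (Complex c (b n))) (f \<epsilon>)
      - integral {a n..b n} (screen_integrand S (f \<epsilon>))) \<longlonglongrightarrow> 0 + \<i> * (2 * of_real pi * V) - 0 - I \<epsilon>"
      unfolding vint(2)[symmetric] I_def
      by (intro tendsto_diff tendsto_add tendsto_mult tendsto_const hor0[OF \<epsilon>] abs_ab
          integral_exhausting_tendsto vint(1) int[OF \<epsilon>] lim_ab) (auto simp: a_def b_def)
    define R where "R n = (\<Sum>\<omega> | \<omega> \<in> spray_dims d L U S \<and> a n < Im \<omega> \<and> Im \<omega> < b n. residue (f \<epsilon>) \<omega>)" for n
    have "(\<lambda>n. 2 * of_real pi * \<i> * R n) \<longlonglongrightarrow> \<i> * (2 * of_real pi * V) - I \<epsilon>"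
    proof (rule Lim_transform_eventually)
      show "\<forall>\<^sub>F n in sequentially. contour_integral (linepath (Complex (S (a n)) (a n)) (Complex c (a n))) (f \<epsilon>)
      + \<i> * integral {a n..b n} (\<lambda>t. f \<epsilon> (Complex c t))
      - contour_integral (linepath (Complex (S (b n)) (b n)) (Complex c (b n))) (f \<epsilon>)
      - integral {a n..b n} (screen_integrand S (f \<epsilon>)) = 2 * of_real pi * \<i> * R n"
        using eventually_ge_at_top[of 1] by eventually_elim (use strip[OF \<epsilon>] R_def in auto)
    qed (use lhs in simp)
    then have "(\<lambda>n. 1 / (2 * of_real pi * \<i>) * (2 * of_real pi * \<i> * R n)) \<longlonglongrightarrow>
        1 / (2 * of_real pi * \<i>) * (\<i> * (2 * of_real pi * V) - I \<epsilon>)"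
      by (intro tendsto_mult tendsto_const)
    then have lim: "R \<longlonglongrightarrow> V - \<R> \<epsilon>"
      by (simp add: \<R>_def field_simps)
    have "has_dims_sum T (spray_dims d L U S) (\<lambda>\<omega>. residue (\<zeta>\<^sub>T \<epsilon>) \<omega>) (V - \<R> \<epsilon>)"
      unfolding has_dims_sum_def a_def[symmetric] b_def[symmetric]
    proof
      show "\<forall>n. finite {\<omega> \<in> spray_dims d L U S. a n < Im \<omega> \<and> Im \<omega> < b n}"
      proof
        fix n
        show "finite {\<omega> \<in> spray_dims d L U S. a n < Im \<omega> \<and> Im \<omega> < b n}"
        proof (cases n)
          \<comment> \<open>Here both bounds of the strip are \<open>T 0\<close>, so it is empty.\<close>
          case 0
          then have "{\<omega> \<in> spray_dims d L U S. a n < Im \<omega> \<and> Im \<omega> < b n} = {}" by (auto simp: a_def b_def)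
          then show ?thesis by (metis finite.emptyI)
        next
          case (Suc m)
          then show ?thesis using strip[OF \<epsilon>, of n] by simp
        qed
      qed
      have "(\<Sum>\<omega> | \<omega> \<in> spray_dims d L U S \<and> a n < Im \<omega> \<and> Im \<omega> < b n. residue (\<zeta>\<^sub>T \<epsilon>) \<omega>) = R n" for n
        unfolding R_def
      proof (rule sum.cong[OF refl])
        fix \<omega> assume "\<omega> \<in> {\<omega>. \<omega> \<in> spray_dims d L U S \<and> a n < Im \<omega> \<and> Im \<omega> < b n}"
        then have "\<omega> \<in> U" using U(3) by (auto simp: spray_dims_def string_dims_def)
        then show "residue (\<zeta>\<^sub>T \<epsilon>) \<omega> = residue (f \<epsilon>) \<omega>" using \<epsilon> by (rule res_eq)
      qed
      then show "(\<lambda>n. \<Sum>\<omega> | \<omega> \<in> spray_dims d L U S \<and> a n < Im \<omega> \<and> Im \<omega> < b n. residue (\<zeta>\<^sub>T \<epsilon>) \<omega>) \<longlonglongrightarrow> V - \<R> \<epsilon>"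
        using lim by simp
    qed
    then show ?thesis by (intro exI[of _ "V - \<R> \<epsilon>"]) (simp add: V_def)
  qed

  define W where "W = M * (K + 1) * (LINT t|lebesgue. decay (2 - \<tau>) t) / (2 * pi)"
  have "norm (\<R> \<epsilon>) \<le> W * \<epsilon> powr (real d - Sup (range S))" if \<epsilon>: "0 < \<epsilon>" "\<epsilon> < 1" for \<epsilon>
  proof -
    define E where "E = \<epsilon> powr (real d - Sup (range S))"
    have bdd: "bdd_above (range S)" using screen by (auto simp: screen_def bounded_imp_bdd_above)
    have "\<epsilon> powr (real d - S t) \<le> E" for t
      unfolding E_def using \<epsilon> cSup_upper[OF _ bdd, of "S t"] by (intro powr_mono') auto
    from bound_AE[OF \<epsilon>(1) this]
    have bd: "AE t in lebesgue. norm (screen_integrand S (f \<epsilon>) t) \<le> (E * M * (K + 1)) * decay (2 - \<tau>) t" .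
    have "norm (I \<epsilon>) \<le> (LINT t|lebesgue. norm (screen_integrand S (f \<epsilon>) t))"
      unfolding I_def by (rule integral_norm_bound)
    also have "\<dots> \<le> (LINT t|lebesgue. (E * M * (K + 1)) * decay (2 - \<tau>) t)"
      using int[OF \<epsilon>(1)] integrable_decay[OF p] bd by (intro integral_mono_AE) auto
    also have "\<dots> = (E * M * (K + 1)) * (LINT t|lebesgue. decay (2 - \<tau>) t)" by simp
    finally have "norm (\<R> \<epsilon>) \<le> ((E * M * (K + 1)) * (LINT t|lebesgue. decay (2 - \<tau>) t)) / (2 * pi)"
      unfolding \<R>_def by (simp add: norm_mult norm_divide divide_right_mono)
    also have "\<dots> = W * E" by (simp add: W_def)
    finally show ?thesis by (simp add: E_def)
  qed
  then have bigO: "(\<lambda>\<epsilon>. norm (\<R> \<epsilon>)) \<in> O[at_right 0](\<lambda>\<epsilon>. \<epsilon> powr (real d - Sup (range S)))"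
    by (intro bigoI[of _ W] eventually_at_rightI[of 0 1]) auto
  have explicit: "(\<lambda>s. of_real \<epsilon> powr (of_nat d - s) * \<zeta>\<^sub>L s / (of_nat d - s) *
             (\<Sum>k<d. of_real g powr (s - of_nat k) / (s - of_nat k) * of_nat (d - k) * of_real (\<kappa> k))) = f \<epsilon>" for \<epsilon>
    by (simp add: fun_eq_iff f_def steiner_kernel_def)
  have hsT: "has_screen_integral S (\<zeta>\<^sub>T \<epsilon>) (I \<epsilon>)" if "\<epsilon> > 0" for \<epsilon>
    using hsi[OF that] by (simp add: has_screen_integral_def \<zeta>T_screen[OF that])
  show ?thesis
    unfolding explicit using main bigO hsi hsT \<R>_def by (intro exI[of _ \<R>]) blast
qed

end
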